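(* Let $K$ and $L$ be origin-symmetric convex bodies in $\mathbb{R}^3$ such that $\Gamma^*_0K\subset\Gamma^*_0L$. Then $\mathrm{vol}(L)\le\mathrm{vol}(K)$.
   Context: A convex body is a compact convex set with non-empty interior in $\mathbb{R}^n$; $\mathrm{vol}$ denotes $n$-dimensional Lebesgue measure (here $n=3$), and $(x,\xi)$ is the standard inner product. Polar $0$-centroid body: $\Gamma^*_0K=\{\xi:\|\xi\|_{\Gamma^*_0K}\le1\}$ is the body with Minkowski functional $$\|\xi\|_{\Gamma^*_0K}=\exp\left(\frac{1}{\mathrm{vol}(K)}\int_K\ln|(x,\xi)|\,dx\right),\quad \xi\in\mathbb{R}^n\setminus\{0\}.$$ Thus $\Gamma^*_0K\subset\Gamma^*_0L$ means that $\frac{1}{\mathrm{vol}(L)}\int_L\ln|(x,\xi)|\,dx\le\frac{1}{\mathrm{vol}(K)}\int_K\ln|(x,\xi)|\,dx$ for every $\xi\in S^{n-1}$. *)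

theory Defs
  imports "HOL-Analysis.Analysis"
begin

definition convex_body :: "'a::euclidean_space set \<Rightarrow> bool" where
  "convex_body K \<longleftrightarrow> compact K \<and> convex K \<and> interior K \<noteq> {}"

definition origin_symmetric :: "'a::euclidean_space set \<Rightarrow> bool" where
  "origin_symmetric K \<longleftrightarrow> uminus ` K = K"

definition vol :: "'a::euclidean_space set \<Rightarrow> real" where
  "vol K = measure lebesgue K"

(* For \<xi> \<noteq> 0 the integrand has its logarithmic singularity on the null set {x. x \<bullet> \<xi> = 0},
   so the library value ln 0 = 0 does not affect the integral. At \<xi> = 0 the exponential
   formula does not apply and the functional takes the value 0, as every Minkowski
   functional does. *)
definition polar_0_centroid_functional :: "'a::euclidean_space set \<Rightarrow> 'a \<Rightarrow> real" where
  "polar_0_centroid_functional K \<xi> =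
    (if \<xi> = 0 then 0
     else exp ((1 / vol K) * set_lebesgue_integral lebesgue K (\<lambda>x. ln \<bar>x \<bullet> \<xi>\<bar>)))"

definition polar_0_centroid_body :: "'a::euclidean_space set \<Rightarrow> 'a set" where
  "polar_0_centroid_body K = {\<xi>. polar_0_centroid_functional K \<xi> \<le> 1}"

end

theory Submission
  imports Defs
begin

text \<open>
  Let \<open>\<parallel>x\<parallel>\<close> be the gauge of \<open>K\<close>. In dimension three \<open>ln \<parallel>x\<parallel>\<close> is, up to a constant, a mixture of the functions
  \<open>ln \<bar>x \<bullet> \<xi>\<bar>\<close> with nonnegative weights, so that the hypothesis gives that the mean of \<open>ln \<parallel>x\<parallel>\<close> over \<open>L\<close>
  is at most its mean over \<open>K\<close>; since \<open>K\<close> is a sublevel set of the gauge, this forces \<open>vol L \<le> vol K\<close>.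

  Only an approximate form of the mixture is needed. Smooth the indicator of \<open>K\<close> with a compactly supported
  radial mollifier that is itself a superposition over \<open>\<xi>\<close> of plane waves \<open>\<phi> (w \<bullet> \<xi>)\<close>, where \<open>\<phi>\<close> is even with
  nonnegative integrals over symmetric intervals. Integrating the smoothed indicator at \<open>s x\<close> against \<open>ds / s\<close>
  gives \<open>- ln \<parallel>x\<parallel>\<close> up to a small error, because the smoothed indicator is constant well inside \<open>K\<close> and vanishes well
  outside. Integrating the plane waves against \<open>ds / s\<close> gives \<open>- ln \<bar>x \<bullet> \<xi>\<bar>\<close> with the weight
  \<open>\<integral>\<^sub>K \<phi> (y \<bullet> \<xi>) dy\<close>, which is nonnegative because the areas of parallel sections of \<open>K\<close> decrease away from the
  origin (Brunn).
\<close>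

subsection \<open>Measure-preserving frames\<close>

text \<open>Formally the weight of \<open>ln \<bar>x \<bullet> \<xi>\<bar>\<close> is, up to a
  positive factor, minus the second derivative at 0 of the area of the sections of \<open>K\<close>
  orthogonal to \<xi>. That derivative need not exist, so a difference of slab volumes at the two
  scales \<open>e\<close> and \<open>3 * e\<close> stands in for it. Dimension three enters through
  Archimedes: a ball of radius R has sections of area pi (R^2 - t^2), so between two concentric
  balls the sections have constant area as long as the plane meets the inner one. Plane waves whose
  profile has mean zero, integrated over such an annulus of \<xi>, therefore cancel exactly away
  from the origin. A solid annulus instead of a sphere keeps everything within Lebesgue measure. The
  integral against ds / s diverges at s = 0 and is cut off at s = \<alpha>. The divergent part
  depends on \<xi> but not on x, so it cancels when the means over \<open>K\<close> and
  \<open>L\<close> are compared. The order of choice matters: \<open>e\<close> is fixed first,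
  according to the ratio of the volumes, and \<alpha> afterwards.\<close>

lemma distr_lborel_orthogonal:
  fixes f :: "real^'n::{finite,wellorder} \<Rightarrow> real^'n::_"
  assumes f: "orthogonal_transformation f"
  shows "distr lborel borel f = lborel"
proof (rule lborel_eqI[symmetric])
  have fm [measurable]: "f \<in> borel_measurable borel"
    using f by (intro borel_measurable_continuous_onI linear_continuous_on linear_conv_bounded_linear[THEN iffD1])
      (simp add: orthogonal_transformation_linear)
  have inv: "orthogonal_transformation (inv f)"
    using f by (rule orthogonal_transformation_inv)
  fix l u :: "real^'n::_" assume le: "\<And>b. b \<in> Basis \<Longrightarrow> l \<bullet> b \<le> u \<bullet> b"
  \<comment> \<open>The known volume formula concerns images, so the preimage is written as an image
    under the inverse, again orthogonal.\<close>
  have eq: "f -` box l u = inv f ` box l u"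
    using orthogonal_transformation_bij[OF f] by (simp add: bij_vimage_eq_inv_image)
  have lm: "box l u \<in> lmeasurable" by simp
  have bd: "bounded (f -` box l u)"
    unfolding eq using inv by (intro bounded_linear_image bounded_box linear_conv_bounded_linear[THEN iffD1])
      (simp add: orthogonal_transformation_linear)
  have [measurable]: "f -` box l u \<in> sets borel"
    using measurable_sets_borel[OF fm, of "box l u"] by simp
  have "emeasure (distr lborel borel f) (box l u) = emeasure lborel (f -` box l u)"
    by (simp add: emeasure_distr)
  also have "\<dots> = ennreal (measure lborel (f -` box l u))"
    using emeasure_bounded_finite[OF bd] by (simp add: emeasure_eq_ennreal_measure)
  also have "measure lborel (f -` box l u) = measure lebesgue (inv f ` box l u)"
    unfolding eq[symmetric] by (simp add: measure_completion)
  also have "\<dots> = measure lebesgue (box l u)"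
    by (rule measure_orthogonal_image[OF inv lm])
  also have "ennreal \<dots> = emeasure lborel (box l u)"
    using emeasure_bounded_finite[OF bounded_box, of l u]
    by (simp add: emeasure_eq_ennreal_measure measure_completion del: measure_lborel_box)
  also have "\<dots> = (\<Prod>b\<in>Basis. (u - l) \<bullet> b)"
    using le by (simp add: emeasure_lborel_box)
  finally show "emeasure (distr lborel borel f) (box l u) = (\<Prod>b\<in>Basis. (u - l) \<bullet> b)" .
qed simp

abbreviation vec3 :: "real \<times> real \<times> real \<Rightarrow> real^3" where
  "vec3 p \<equiv> vector [fst p, fst (snd p), snd (snd p)]"

lemma linear_vec3: "linear vec3"
  by (rule linearI) (simp_all add: vec_eq_iff forall_3)

lemma distr_lborel_vec3: "distr lborel borel vec3 = lborel"
proof (rule lborel_eqI[symmetric])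
  have fm [measurable]: "vec3 \<in> borel_measurable borel"
    by (intro borel_measurable_continuous_onI linear_continuous_on linear_conv_bounded_linear[THEN iffD1] linear_vec3)
  fix l u :: "real^3" assume le: "\<And>b. b \<in> Basis \<Longrightarrow> l \<bullet> b \<le> u \<bullet> b"
  have le': "l $ i \<le> u $ i" for i
    using le[of "axis i 1"] by (simp add: inner_axis' axis_in_Basis_iff inner_axis)
  have eq: "vec3 -` box l u = box (l$1, l$2, l$3) (u$1, u$2, u$3)"
    proof (rule set_eqI)
    fix p :: "real \<times> real \<times> real"
    have "p \<in> vec3 -` box l u \<longleftrightarrow> (l$1 < fst p \<and> fst p < u$1) \<and> (l$2 < fst (snd p) \<and> fst (snd p) < u$2)
        \<and> (l$3 < snd (snd p) \<and> snd (snd p) < u$3)"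
      by (simp add: mem_box_cart forall_3)
    also have "\<dots> \<longleftrightarrow> p \<in> box (l$1, l$2, l$3) (u$1, u$2, u$3)"
      by (cases p) (auto simp: box_prod)
    finally show "p \<in> vec3 -` box l u \<longleftrightarrow> p \<in> box (l$1, l$2, l$3) (u$1, u$2, u$3)" .
  qed
  have "emeasure (distr lborel borel vec3) (box l u) = emeasure lborel (vec3 -` box l u)"
    by (simp add: emeasure_distr)
  also have "\<dots> = ennreal ((u$1 - l$1) * ((u$2 - l$2) * (u$3 - l$3)))"
  proof -
    have "(u$1 - l$1) * ((u$2 - l$2) * (u$3 - l$3)) =
      (\<Prod>b\<in>Basis. ((u$1, u$2, u$3) - (l$1, l$2, l$3)) \<bullet> b)"
      by (simp add: Basis_prod_def prod.union_disjoint prod.reindex inj_on_def image_Un)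
    then show ?thesis unfolding eq
      by (subst emeasure_lborel_box) (auto simp: Basis_prod_def le')
  qed
  also have "(u$1 - l$1) * ((u$2 - l$2) * (u$3 - l$3)) = (\<Prod>b\<in>Basis. (u - l) \<bullet> b)"
  proof -
    have B: "Basis = (\<lambda>i::3. axis i (1::real)) ` UNIV"
      by (auto simp: Basis_vec_def)
    have inj: "inj (\<lambda>i::3. axis i (1::real))"
      by (auto simp: inj_on_def axis_eq_axis)
    have "(\<Prod>b\<in>Basis. (u - l) \<bullet> b) = (\<Prod>i\<in>UNIV. (u - l) \<bullet> axis (i::3) (1::real))"
      unfolding B prod.reindex[OF inj] o_def ..
    also have "\<dots> = (u$1 - l$1) * ((u$2 - l$2) * (u$3 - l$3))"
      unfolding UNIV_3 by (simp add: inner_axis)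
    finally show ?thesis by simp
  qed
  finally show "emeasure (distr lborel borel vec3) (box l u) = (\<Prod>b\<in>Basis. (u - l) \<bullet> b)" .
qed simp

text \<open>Planes orthogonal to \<xi> become slices of a product over the first coordinate, so that
  slab volumes can be computed by Fubini.\<close>

lemma adapted_frame:
  fixes \<xi> :: "real^3"
  obtains T :: "real \<times> real \<times> real \<Rightarrow> real^3"
  where "linear T" "\<And>p. norm (T p) = norm p" "\<And>t p. T (t, p) \<bullet> \<xi> = norm \<xi> * t"
    "distr lborel borel T = lborel"
proof -
  \<comment> \<open>The axis vector gets the length of \<xi>, since an orthogonal map can only match
    vectors of equal norm.\<close>
  have "norm (axis 1 (norm \<xi>) :: real^3) = norm \<xi>"
    by (simp add: norm_eq_sqrt_inner[of "axis _ _"] inner_axis_axis)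
  then obtain f :: "real^3 \<Rightarrow> real^3" where f: "orthogonal_transformation f" "f (axis 1 (norm \<xi>)) = \<xi>"
    by (rule orthogonal_transformation_exists)
  let ?T = "\<lambda>p. f (vec3 p)"
  have lin: "linear f" using f(1) by (rule orthogonal_transformation_linear)
  have [measurable]: "f \<in> borel_measurable borel"  "vec3 \<in> borel_measurable borel"
    by (intro borel_measurable_continuous_onI linear_continuous_on linear_conv_bounded_linear[THEN iffD1] linear_vec3 lin)+
  show ?thesis
  proof
    show "linear ?T"
      using linear_compose[OF linear_vec3 lin] by (simp add: o_def)
    show "norm (?T p) = norm p" for p
    proof -
      have "norm (vec3 p) = norm p"
        by (cases p) (simp add: norm_vec_def L2_set_def sum_3 norm_Pair add.assoc)
      then show ?thesis
        using f(1) by (simp add: orthogonal_transformation_norm)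
    qed
    show "?T (t, p) \<bullet> \<xi> = norm \<xi> * t" for t p
    proof -
      have "?T (t, p) \<bullet> \<xi> = f (vec3 (t, p)) \<bullet> f (axis 1 (norm \<xi>))"
        by (simp add: f(2))
      also have "\<dots> = vec3 (t, p) \<bullet> axis 1 (norm \<xi>)"
        using f(1) by (simp add: orthogonal_transformation_def)
      finally show ?thesis by (simp add: inner_axis)
    qed
    have "distr lborel borel ?T = distr (distr lborel borel vec3) borel f"
      by (simp add: distr_distr o_def)
    then show "distr lborel borel ?T = lborel"
      by (simp add: distr_lborel_vec3 distr_lborel_orthogonal f(1))
  qed
qed

subsection \<open>A planar Brunn--Minkowski inequality\<close>

text \<open>Brunn-Minkowski on the line, where compact convex sets are intervals. A negative
  \<open>t\<close> merely reverses the second interval, hence the absolute value; sums and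
  differences are thus covered together.\<close>

lemma measure_interval_combination:
  fixes I J M :: "real set" and s t :: real
  assumes I: "compact I" "convex I" "I \<noteq> {}" and J: "compact J" "convex J" "J \<noteq> {}"
    and M: "compact M" "convex M" and s: "0 \<le> s"
    and sub: "\<And>x y. x \<in> I \<Longrightarrow> y \<in> J \<Longrightarrow> s * x + t * y \<in> M"
  shows "s * measure lborel I + \<bar>t\<bar> * measure lborel J \<le> measure lborel M"
proof -
  obtain a b where ab: "I = {a..b}" "a \<le> b"
    using I connected_compact_interval_1[of I] by (auto simp: convex_connected)
  obtain c d where cd: "J = {c..d}" "c \<le> d"
    using J connected_compact_interval_1[of J] by (auto simp: convex_connected)
  obtain e f where ef: "M = {e..f}"
    using M connected_compact_interval_1[of M] by (auto simp: convex_connected)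
  have mem: "s * a + t * c \<in> {e..f}" "s * a + t * d \<in> {e..f}"
    "s * b + t * c \<in> {e..f}" "s * b + t * d \<in> {e..f}"
    using sub ab cd ef by auto
  show ?thesis
  proof (cases "0 \<le> t")
    case True
    then show ?thesis using mem ab cd ef by (auto simp: algebra_simps)
  next
    case False
    then show ?thesis using mem ab cd ef by (auto simp: algebra_simps)
  qed
qed

lemma nn_integral_layer_cake:
  fixes f :: "'a::euclidean_space \<Rightarrow> real"
  assumes [measurable]: "f \<in> borel_measurable borel" and "\<And>x. 0 \<le> f x"
  shows "(\<integral>\<^sup>+x. ennreal (f x) \<partial>lborel) = (\<integral>\<^sup>+r. emeasure lborel {x. 0 \<le> r \<and> r < f x} \<partial>lborel)"
proof -
  have "(\<integral>\<^sup>+x. ennreal (f x) \<partial>lborel) = (\<integral>\<^sup>+x. (\<integral>\<^sup>+r. indicator {0..<f x} r \<partial>lborel) \<partial>lborel)"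
    using assms(2) by (intro nn_integral_cong) simp
  also have "\<dots> = (\<integral>\<^sup>+x. (\<integral>\<^sup>+r. indicator {p. 0 \<le> snd p \<and> snd p < f (fst p)} (x, r) \<partial>lborel) \<partial>lborel)"
    by (intro nn_integral_cong) (auto simp: indicator_def)
  also have "\<dots> = (\<integral>\<^sup>+r. (\<integral>\<^sup>+x. indicator {p. 0 \<le> snd p \<and> snd p < f (fst p)} (x, r) \<partial>lborel) \<partial>lborel)"
    by (intro lborel_pair.Fubini'[symmetric]) measurable
  also have "\<dots> = (\<integral>\<^sup>+r. (\<integral>\<^sup>+x. indicator {x. 0 \<le> r \<and> r < f x} x \<partial>lborel) \<partial>lborel)"
    by (intro nn_integral_cong) (auto simp: indicator_def)
  also have "\<dots> = (\<integral>\<^sup>+r. emeasure lborel {x. 0 \<le> r \<and> r < f x} \<partial>lborel)"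
    by (intro nn_integral_cong nn_integral_indicator) measurable
  finally show ?thesis .
qed

lemma emeasure_lborel_slices:
  fixes A :: "('a::euclidean_space \<times> 'b::euclidean_space) set"
  assumes "A \<in> sets borel"
  shows "emeasure lborel A = (\<integral>\<^sup>+x. emeasure lborel (Pair x -` A) \<partial>lborel)"
proof -
  have "A \<in> sets (lborel \<Otimes>\<^sub>M lborel)"
    using assms unfolding lborel_prod by simp
  then have "emeasure (lborel \<Otimes>\<^sub>M lborel) A = (\<integral>\<^sup>+x. emeasure lborel (Pair x -` A) \<partial>lborel)"
    by (rule lborel.emeasure_pair_measure_alt)
  then show ?thesis by (simp only: lborel_prod)
qed

lemma compact_slice:
  fixes A :: "('a::euclidean_space \<times> 'b::euclidean_space) set"
  assumes "compact A"
  shows "compact (Pair x -` A)"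
proof -
  have "closed (Pair x -` A)"
    using assms by (intro closed_vimage compact_imp_closed continuous_intros)
  moreover have "Pair x -` A \<subseteq> snd ` A" by force
  moreover have "bounded (snd ` A)"
    using assms by (intro compact_imp_bounded compact_continuous_image continuous_intros)
  ultimately show ?thesis
    by (meson bounded_subset compact_eq_bounded_closed)
qed

lemma convex_slice:
  assumes "convex A"
  shows "convex (Pair x -` A)"
proof (rule convexI)
  fix p q and u v :: real
  assume "p \<in> Pair x -` A" "q \<in> Pair x -` A" and uv: "0 \<le> u" "0 \<le> v" "u + v = 1"
  then have "u *\<^sub>R (x, p) + v *\<^sub>R (x, q) \<in> A"
    using assms by (intro convexD) auto
  then show "u *\<^sub>R p + v *\<^sub>R q \<in> Pair x -` A"
    using uv by (simp flip: scaleR_add_left)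
qed

text \<open>If \<open>E\<close> has endpoints a and b, the differences contain the open interval
  from s a - t b to s b - t a, of length (s + t) (b - a) = b - a. Only interior points of
  \<open>E\<close> are used, because superlevel sets given by a strict inequality may lack their
  endpoints.\<close>

lemma emeasure_convex_le_difference:
  fixes E E' :: "real set"
  assumes E: "convex E" "bounded E" and E': "E' \<in> sets borel" and st: "0 \<le> s" "0 \<le> t" "s + t = 1"
    and sub: "\<And>x y. x \<in> E \<Longrightarrow> y \<in> E \<Longrightarrow> s * x - t * y \<in> E'"
  shows "emeasure lborel E \<le> emeasure lborel E'"
proof (cases "E = {}")
  case False
  define a b where "a = Inf E" and "b = Sup E"
  have bdd: "bdd_above E" "bdd_below E"
    using E(2) by (auto intro: bounded_imp_bdd_above bounded_imp_bdd_below)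
  have sub1: "E \<subseteq> {a..b}"
    unfolding a_def b_def using bdd by (auto intro: cInf_lower cSup_upper)
  have ab: "a \<le> b" using False sub1 by force
  have mid: "x \<in> E" if lower: "a < x" and upper: "x < b" for x
  proof -
    obtain l where "l \<in> E" "l < x"
      using cInf_lessD[OF False] lower unfolding a_def by blast
    moreover obtain u where "u \<in> E" "x < u"
      using less_cSupD[OF False] upper unfolding b_def by blast
    ultimately show ?thesis
      using E(1) unfolding is_interval_convex_1[symmetric] is_interval_1 by (meson less_imp_le)
  qed
  have len: "b - a = (s * b - t * a) - (s * a - t * b)"
  proof -
    have "(s * b - t * a) - (s * a - t * b) = (s + t) * (b - a)"
      by (simp add: algebra_simps)
    then show ?thesis using st by simp
  qed
  have sub2: "{s * a - t * b <..< s * b - t * a} \<subseteq> E'"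
  proof
    fix z assume z: "z \<in> {s * a - t * b <..< s * b - t * a}"
    have "a < b" using z len by simp
    \<comment> \<open>The points a + r (b - a) and b - r (b - a) move inwards at equal speed; along
      them s x - t y runs affinely through the whole target interval.\<close>
    define r where "r = (z - (s * a - t * b)) / (b - a)"
    have r: "0 < r" "r < 1"
      using z \<open>a < b\<close> len by (auto simp: r_def divide_less_eq)
    have rz: "r * (b - a) = z - (s * a - t * b)"
      using \<open>a < b\<close> by (simp add: r_def)
    have "0 < r * (b - a)" "r * (b - a) < b - a"
      using r \<open>a < b\<close> mult_strict_right_mono[of r 1 "b - a"] by simp_all
    then have x1: "a < a + r * (b - a)" "a < b - r * (b - a)"
      "a + r * (b - a) < b" "b - r * (b - a) < b"
      by linarith+
    have "s * (a + r * (b - a)) - t * (b - r * (b - a)) = s * a - t * b + (s + t) * (r * (b - a))"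
      by (simp add: algebra_simps)
    also have "\<dots> = z" using rz st by simp
    finally show "z \<in> E'"
      using sub[OF mid mid] x1 by metis
  qed
  have "emeasure lborel E \<le> emeasure lborel {a..b}"
    using sub1 by (intro emeasure_mono) auto
  also have "\<dots> = ennreal (b - a)" using ab by simp
  also have "b - a = (s * b - t * a) - (s * a - t * b)" by (rule len)
  also have "ennreal \<dots> \<le> emeasure lborel {s * a - t * b <..< s * b - t * a}"
    by (cases "s * a - t * b \<le> s * b - t * a") (auto simp: ennreal_neg)
  also have "\<dots> \<le> emeasure lborel E'"
    using sub2 E' by (intro emeasure_mono) auto
  finally show ?thesis .
qed simp

text \<open>The superlevel sets of the chord length are intervals, so that on each level only lengths of
  intervals have to be compared.\<close>

lemma emeasure_planar_difference:
  fixes S S' :: "(real \<times> real) set"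
  assumes S: "compact S" "convex S" and S': "compact S'" "convex S'"
    and st: "0 \<le> s" "0 \<le> t" "s + t = 1"
    and sub: "\<And>p q. p \<in> S \<Longrightarrow> q \<in> S \<Longrightarrow> s *\<^sub>R p - t *\<^sub>R q \<in> S'"
  shows "emeasure lborel S \<le> emeasure lborel S'"
proof -
  define len where "len A u = measure lborel (Pair u -` A)" for A :: "(real \<times> real) set" and u
  have emeas: "emeasure lborel (Pair u -` A) = ennreal (len A u)" if "compact A" for A :: "(real \<times> real) set" and u
    unfolding len_def using emeasure_bounded_finite[OF compact_imp_bounded[OF compact_slice[OF that]]]
    by (intro emeasure_eq_ennreal_measure) (simp add: less_top)
  have lenm [measurable]: "len A \<in> borel_measurable borel" if "compact A" for A
  proof -
    have "A \<in> sets (borel \<Otimes>\<^sub>M lborel)"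
      using borel_compact[OF that] by (metis borel_prod sets_lborel sets_pair_measure_cong)
    then have "(\<lambda>u. emeasure lborel (Pair u -` A)) \<in> borel_measurable borel"
      by (rule lborel.measurable_emeasure_Pair)
    then show ?thesis
      unfolding len_def measure_def by measurable
  qed
  have eq: "emeasure lborel A = (\<integral>\<^sup>+r. emeasure lborel {u. 0 \<le> r \<and> r < len A u} \<partial>lborel)"
    if "compact A" for A
    using emeasure_lborel_slices[OF borel_compact[OF that]] nn_integral_layer_cake[OF lenm[OF that]]
    by (simp add: emeas[OF that] len_def)
  \<comment> \<open>Strictness of the level matters: an empty chord has length 0 and is excluded
    even at level 0.\<close>
  have ne: "Pair u -` A \<noteq> {}" if "0 \<le> r" "r < len A u" for u r A
    using that by (auto simp: len_def)
  \<comment> \<open>Chords over \<open>u1\<close> and \<open>u2\<close> combine into part of the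
    chord over the combined abscissa. With \<open>S\<close> itself and nonnegative coefficients this
    gives convexity of the level sets; with \<open>S'\<close> and a negative second coefficient it
    gives the comparison.\<close>
  have comb: "c1 * len S u1 + \<bar>c2\<bar> * len S u2 \<le> len A (c1 * u1 + c2 * u2)"
    if "0 \<le> r" "r < len S u1" "r < len S u2" "0 \<le> c1" "compact A" "convex A"
      "\<And>p q. p \<in> S \<Longrightarrow> q \<in> S \<Longrightarrow> c1 *\<^sub>R p + c2 *\<^sub>R q \<in> A"
    for u1 u2 r c1 c2 A
    unfolding len_def
  proof (rule measure_interval_combination)
    show "c1 * x + c2 * y \<in> Pair (c1 * u1 + c2 * u2) -` A"
      if "x \<in> Pair u1 -` S" "y \<in> Pair u2 -` S" for x y
      using that \<open>\<And>p q. p \<in> S \<Longrightarrow> q \<in> S \<Longrightarrow> c1 *\<^sub>R p + c2 *\<^sub>R q \<in> A\<close>[of "(u1, x)" "(u2, y)"] by simp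
  qed (use that S ne in \<open>auto intro!: compact_slice convex_slice\<close>)
  have level: "emeasure lborel {u. 0 \<le> r \<and> r < len S u} \<le> emeasure lborel {u. 0 \<le> r \<and> r < len S' u}" for r
  proof (cases "0 \<le> r")
    case r: True
    have "emeasure lborel {u. r < len S u} \<le> emeasure lborel {u. r < len S' u}"
    proof (rule emeasure_convex_le_difference[OF _ _ _ st])
      show "convex {u. r < len S u}"
      proof (rule convexI)
        fix x y u v :: real
        assume h: "x \<in> {u. r < len S u}" "y \<in> {u. r < len S u}" "0 \<le> u" "0 \<le> v" "u + v = 1"
        have "u * r + v * r < u * len S x + v * len S y"
          using h by (cases "u = 0") (auto intro!: add_less_le_mono mult_left_mono)
        also have "\<dots> \<le> len S (u * x + v * y)"
          using comb[of r x y u S v] h r S by (auto simp: convexD)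
        finally show "u *\<^sub>R x + v *\<^sub>R y \<in> {u. r < len S u}"
          using h by (simp flip: distrib_right)
      qed
      have "{u. r < len S u} \<subseteq> fst ` S"
        using ne[OF r] by force
      moreover have "bounded (fst ` S)"
        by (intro compact_imp_bounded compact_continuous_image continuous_intros S)
      ultimately show "bounded {u. r < len S u}"
        by (rule bounded_subset[rotated])
      show "{u. r < len S' u} \<in> sets borel"
        using lenm[OF S'(1)] by measurable
      show "s * x - t * y \<in> {u. r < len S' u}" if "x \<in> {u. r < len S u}" "y \<in> {u. r < len S u}" for x y
      proof -
        have "s * r + t * r < s * len S x + t * len S y"
          using that st by (cases "s = 0") (auto intro!: add_less_le_mono mult_left_mono)
        also have "\<dots> \<le> len S' (s * x + (- t) * y)"
          using comb[of r x y s S' "- t"] that r S' st sub by auto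
        finally show ?thesis using st by (simp flip: distrib_right)
      qed
    qed
    then show ?thesis using r by simp
  qed simp
  show ?thesis
    unfolding eq[OF S(1)] eq[OF S'(1)] by (intro nn_integral_mono level)
qed

text \<open>The slice at - 3 t is minus the slice at 3 t, and t = 2/3 (3 t) + 1/3 (- 3 t), so
  convexity puts the weighted differences of the slice at 3 t into the slice at t. This one ratio of
  Brunn's monotonicity is what a kernel with scales e and 3 e calls for.\<close>

lemma emeasure_slice_convex_symmetric:
  fixes C :: "(real \<times> real \<times> real) set"
  assumes C: "compact C" "convex C" and sym: "\<And>p. p \<in> C \<Longrightarrow> - p \<in> C"
  shows "emeasure lborel (Pair (3 * t) -` C) \<le> emeasure lborel (Pair t -` C)"
proof (rule emeasure_planar_difference[where s="2/3" and t="1/3"])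
  fix p q assume "p \<in> Pair (3 * t) -` C" "q \<in> Pair (3 * t) -` C"
  then have "(2/3) *\<^sub>R (3 * t, p) + (1/3) *\<^sub>R (- (3 * t, q)) \<in> C"
    by (intro convexD[OF C(2)] sym) auto
  then show "(2/3) *\<^sub>R p - (1/3) *\<^sub>R q \<in> Pair t -` C"
    by simp
qed (use C in \<open>auto intro: compact_slice convex_slice\<close>)

text \<open>Substituting 3 t for t brings both slabs to the same range of heights, so that they can
  be compared slice by slice.\<close>

lemma emeasure_slab_rescale:
  fixes A :: "(real \<times> 'b::euclidean_space) set"
  assumes A [measurable]: "A \<in> sets borel"
  shows "emeasure lborel {p \<in> A. \<bar>fst p\<bar> \<le> 3 * h}
    = 3 * (\<integral>\<^sup>+t. emeasure lborel (Pair (3 * t) -` A) * indicator {-h..h} t \<partial>lborel)"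
    and "emeasure lborel {p \<in> A. \<bar>fst p\<bar> \<le> h}
    = (\<integral>\<^sup>+t. emeasure lborel (Pair t -` A) * indicator {-h..h} t \<partial>lborel)"
proof -
  have m [measurable]: "(\<lambda>u. emeasure lborel (Pair u -` A)) \<in> borel_measurable borel"
  proof -
    have "A \<in> sets (borel \<Otimes>\<^sub>M lborel)"
      using A by (metis borel_prod sets_lborel sets_pair_measure_cong)
    then show ?thesis
      by (rule lborel.measurable_emeasure_Pair)
  qed
  have gen: "emeasure lborel {p \<in> A. \<bar>fst p\<bar> \<le> h}
    = (\<integral>\<^sup>+t. emeasure lborel (Pair t -` A) * indicator {-h..h} t \<partial>lborel)" for h
  proof -
    have "closed {p :: real \<times> 'b. \<bar>fst p\<bar> \<le> h}"
      by (intro closed_Collect_le continuous_intros)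
    then have "A \<inter> {p. \<bar>fst p\<bar> \<le> h} \<in> sets borel"
      using A by (intro sets.Int) auto
    then have "{p \<in> A. \<bar>fst p\<bar> \<le> h} \<in> sets borel"
      by (simp add: Int_def)
    then have "emeasure lborel {p \<in> A. \<bar>fst p\<bar> \<le> h} = (\<integral>\<^sup>+t. emeasure lborel (Pair t -` {p \<in> A. \<bar>fst p\<bar> \<le> h}) \<partial>lborel)"
      by (rule emeasure_lborel_slices)
    also have "\<dots> = (\<integral>\<^sup>+t. emeasure lborel (Pair t -` A) * indicator {-h..h} t \<partial>lborel)"
      by (intro nn_integral_cong) (auto simp: indicator_def vimage_def abs_le_iff)
    finally show ?thesis .
  qed
  show "emeasure lborel {p \<in> A. \<bar>fst p\<bar> \<le> h}
    = (\<integral>\<^sup>+t. emeasure lborel (Pair t -` A) * indicator {-h..h} t \<partial>lborel)"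
    by (rule gen)
  have "emeasure lborel {p \<in> A. \<bar>fst p\<bar> \<le> 3 * h}
    = 3 * (\<integral>\<^sup>+t. emeasure lborel (Pair (3 * t) -` A) * indicator {-(3*h)..3*h} (3 * t) \<partial>lborel)"
    unfolding gen by (subst nn_integral_real_affine[where c=3 and t=0]) auto
  also have "(\<lambda>t. indicator {-(3*h)..3*h} (3 * t)) = (indicator {-h..h} :: real \<Rightarrow> ennreal)"
    by (auto simp: indicator_def fun_eq_iff)
  then have "(\<integral>\<^sup>+t. emeasure lborel (Pair (3 * t) -` A) * indicator {-(3*h)..3*h} (3 * t) \<partial>lborel)
    = (\<integral>\<^sup>+t. emeasure lborel (Pair (3 * t) -` A) * indicator {-h..h} t \<partial>lborel)"
    by metis
  finally show "emeasure lborel {p \<in> A. \<bar>fst p\<bar> \<le> 3 * h}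
    = 3 * (\<integral>\<^sup>+t. emeasure lborel (Pair (3 * t) -` A) * indicator {-h..h} t \<partial>lborel)" .
qed

subsection \<open>Slabs in convex bodies and in the annulus\<close>

lemma emeasure_distr_lborel:
  fixes T :: "'a::euclidean_space \<Rightarrow> 'b::euclidean_space"
  assumes "linear T" "distr lborel borel T = lborel" "A \<in> sets borel"
  shows "emeasure lborel A = emeasure lborel (T -` A)"
proof -
  have "T \<in> borel_measurable borel"
    using assms(1) by (intro borel_measurable_continuous_onI linear_continuous_on)
      (simp add: linear_conv_bounded_linear)
  then have "emeasure (distr lborel borel T) A = emeasure lborel (T -` A)"
    using assms(3) by (simp add: emeasure_distr)
  then show ?thesis using assms(2) by simp
qed

lemma emeasure_lborel_Times:
  fixes A :: "'a::euclidean_space set" and B :: "'b::euclidean_space set"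
  assumes "A \<in> sets borel" "B \<in> sets borel"
  shows "emeasure lborel (A \<times> B) = emeasure lborel A * emeasure lborel B"
  using assms lborel.emeasure_pair_measure_Times[of A lborel B] by (simp add: lborel_prod)

lemma borel_slab [measurable]: "{y :: 'a::euclidean_space. \<bar>y \<bullet> \<xi> - t\<bar> \<le> h} \<in> sets borel"
  by (intro borel_closed closed_Collect_le continuous_intros)

text \<open>In an adapted frame the set lies in a box with sides 2 h / \<open>norm \<xi>\<close>, 2
  \<rho> and 2 \<rho>.\<close>

lemma emeasure_slab_le:
  fixes \<xi> :: "real^3"
  assumes "\<xi> \<noteq> 0" "0 \<le> \<rho>" "0 \<le> h"
  shows "emeasure lborel {y. norm y \<le> \<rho> \<and> \<bar>y \<bullet> \<xi> - t\<bar> \<le> h} \<le> ennreal (8 * \<rho>\<^sup>2 * h / norm \<xi>)"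
proof -
  obtain T :: "real \<times> real \<times> real \<Rightarrow> real^3" where T: "linear T" "\<And>p. norm (T p) = norm p"
    "\<And>t p. T (t, p) \<bullet> \<xi> = norm \<xi> * t" "distr lborel borel T = lborel"
    using adapted_frame by blast
  let ?A = "{y. norm y \<le> \<rho> \<and> \<bar>y \<bullet> \<xi> - t\<bar> \<le> h}"
  let ?n = "norm \<xi>"
  have n: "0 < ?n" using assms by simp
  have "?A \<in> sets borel"
    by (intro borel_closed closed_Collect_conj closed_Collect_le continuous_intros)
  then have "emeasure lborel ?A = emeasure lborel (T -` ?A)"
    by (rule emeasure_distr_lborel[OF T(1,4)])
  also have "\<dots> \<le> emeasure lborel ({(t - h) / ?n..(t + h) / ?n} \<times> {-\<rho>..\<rho>} \<times> {-\<rho>..\<rho>})"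
  proof (intro emeasure_mono subsetI)
    fix p assume "p \<in> T -` ?A"
    moreover obtain a b c where p: "p = (a, b, c)" by (cases p)
    ultimately have h: "norm (a, b, c) \<le> \<rho>" "\<bar>?n * a - t\<bar> \<le> h"
      using T(2,3) by auto
    have "norm (b, c) \<le> \<rho>"
      using h(1) norm_snd_le[of "(b, c)" a] by simp
    then have "norm b \<le> \<rho>" "norm c \<le> \<rho>"
      using norm_fst_le[of b c] norm_snd_le[of c b] by auto
    then show "p \<in> {(t - h) / ?n..(t + h) / ?n} \<times> {-\<rho>..\<rho>} \<times> {-\<rho>..\<rho>}"
      using h(2) n by (auto simp: p field_simps abs_le_iff)
  qed (auto intro!: borel_closed closed_Times)
  also have "\<dots> = emeasure lborel {(t - h) / ?n..(t + h) / ?n} * (emeasure lborel {-\<rho>..\<rho>} * emeasure lborel {-\<rho>..\<rho>})"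
    by (simp add: emeasure_lborel_Times borel_closed closed_Times)
  also have "\<dots> = ennreal (((t + h) / ?n - (t - h) / ?n) * ((2 * \<rho>) * (2 * \<rho>)))"
    using assms n by (simp add: ennreal_mult'[symmetric] ennreal_mult''[symmetric] divide_right_mono)
  also have "((t + h) / ?n - (t - h) / ?n) * ((2 * \<rho>) * (2 * \<rho>)) = 8 * \<rho>\<^sup>2 * h / ?n"
    using n by (simp add: field_simps power2_eq_square)
  finally show ?thesis .
qed

lemma emeasure_slab_frame:
  fixes \<xi> :: "real^3"
  assumes "\<xi> \<noteq> 0" and T: "linear T" "\<And>t p. T (t, p) \<bullet> \<xi> = norm \<xi> * t" "distr lborel borel T = lborel"
    and A: "A \<in> sets borel"
  shows "emeasure lborel {y \<in> A. \<bar>y \<bullet> \<xi>\<bar> \<le> h} = emeasure lborel {p \<in> T -` A. \<bar>fst p\<bar> \<le> h / norm \<xi>}"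
proof -
  have "A \<inter> {y. \<bar>y \<bullet> \<xi> - 0\<bar> \<le> h} \<in> sets borel"
    using A by (intro sets.Int borel_slab) auto
  then have "{y \<in> A. \<bar>y \<bullet> \<xi>\<bar> \<le> h} \<in> sets borel"
    by (simp add: Int_def)
  then have "emeasure lborel {y \<in> A. \<bar>y \<bullet> \<xi>\<bar> \<le> h} = emeasure lborel (T -` {y \<in> A. \<bar>y \<bullet> \<xi>\<bar> \<le> h})"
    by (rule emeasure_distr_lborel[OF T(1,3)])
  also have "T -` {y \<in> A. \<bar>y \<bullet> \<xi>\<bar> \<le> h} = {p \<in> T -` A. \<bar>fst p\<bar> \<le> h / norm \<xi>}"
    using assms(1) T(2) by (auto simp: abs_mult field_simps)
  finally show ?thesis .
qed

lemma borel_vimage_linear: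
  fixes T :: "'a::euclidean_space \<Rightarrow> 'b::euclidean_space"
  assumes "linear T" "A \<in> sets borel"
  shows "T -` A \<in> sets borel"
proof -
  have "T \<in> borel_measurable borel"
    using assms(1) by (intro borel_measurable_continuous_onI linear_continuous_on)
      (simp add: linear_conv_bounded_linear)
  then show ?thesis
    using assms(2) measurable_sets_borel by blast
qed

lemma emeasure_central_slab:
  fixes K :: "(real^3) set"
  assumes K: "compact K" "convex K" and sym: "\<And>y. y \<in> K \<Longrightarrow> - y \<in> K" and "\<xi> \<noteq> 0"
  shows "emeasure lborel {y \<in> K. \<bar>y \<bullet> \<xi>\<bar> \<le> 3 * h} \<le> 3 * emeasure lborel {y \<in> K. \<bar>y \<bullet> \<xi>\<bar> \<le> h}"
proof -
  obtain T :: "real \<times> real \<times> real \<Rightarrow> real^3" where T: "linear T" "\<And>p. norm (T p) = norm p"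
    "\<And>t p. T (t, p) \<bullet> \<xi> = norm \<xi> * t" "distr lborel borel T = lborel"
    using adapted_frame by blast
  let ?C = "T -` K"
  have Kb: "K \<in> sets borel" using K(1) by (rule borel_compact)
  have Cb: "?C \<in> sets borel" by (rule borel_vimage_linear[OF T(1) Kb])
  have "closed ?C"
    using K(1) T(1) by (intro closed_vimage compact_imp_closed linear_continuous_on)
      (simp_all add: linear_conv_bounded_linear)
  moreover have "bounded ?C"
  proof -
    obtain B where "\<forall>y\<in>K. norm y \<le> B"
      using compact_imp_bounded[OF K(1)] unfolding bounded_iff by blast
    then have "\<forall>p\<in>?C. norm p \<le> B"
      using T(2) by (metis vimageD)
    then show ?thesis unfolding bounded_iff by blast
  qed
  ultimately have "compact ?C"
    by (simp add: compact_eq_bounded_closed)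
  moreover have "convex ?C"
    by (rule convex_linear_vimage[OF T(1) K(2)])
  ultimately have le: "emeasure lborel (Pair (3 * t) -` ?C) \<le> emeasure lborel (Pair t -` ?C)" for t
    using sym by (intro emeasure_slice_convex_symmetric) (auto simp: linear_neg[OF T(1)])
  have "emeasure lborel {y \<in> K. \<bar>y \<bullet> \<xi>\<bar> \<le> 3 * h}
    = 3 * (\<integral>\<^sup>+t. emeasure lborel (Pair (3 * t) -` ?C) * indicator {-(h / norm \<xi>)..h / norm \<xi>} t \<partial>lborel)"
    unfolding emeasure_slab_frame[OF assms(4) T(1,3,4) Kb]
    using emeasure_slab_rescale(1)[OF Cb, of "h / norm \<xi>"] by simp
  also have "\<dots> \<le> 3 * (\<integral>\<^sup>+t. emeasure lborel (Pair t -` ?C) * indicator {-(h / norm \<xi>)..h / norm \<xi>} t \<partial>lborel)"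
    using le by (intro mult_left_mono nn_integral_mono mult_right_mono) auto
  also have "\<dots> = 3 * emeasure lborel {y \<in> K. \<bar>y \<bullet> \<xi>\<bar> \<le> h}"
    unfolding emeasure_slab_frame[OF assms(4) T(1,3,4) Kb]
    using emeasure_slab_rescale(2)[OF Cb, of "h / norm \<xi>"] by simp
  finally show ?thesis .
qed

text \<open>A thickened sphere of directions: its planar sections at heights up to 1 all have the
  same area, and the two bounds on the norm make all constants uniform in \<xi>.\<close>

definition annulus :: "(real^3) set" where
  "annulus = cball 0 2 - cball 0 1"

lemma borel_annulus [measurable]: "annulus \<in> sets borel"
  unfolding annulus_def by (intro sets.Diff borel_closed closed_cball)

lemma annulus_nonzero: "\<xi> \<in> annulus \<Longrightarrow> \<xi> \<noteq> 0"
  by (auto simp: annulus_def)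

text \<open>A disc of squared radius 4 - t^2 without a disc of squared radius 1 - t^2;
  \<open>max 0\<close> accounts for planes that miss a ball. For \<bar>t\<bar> \<le> 1 the terms t^2
  cancel, which is special to dimension three.\<close>

lemma emeasure_annulus_slice:
  "emeasure lborel {q :: real \<times> real. norm (t :: real, q) \<in> {1<..2}}
    = ennreal (unit_ball_vol 2 * (max 0 (4 - t\<^sup>2) - max 0 (1 - t\<^sup>2)))"
proof -
  define D where "D s = {q :: real \<times> real. (norm q)\<^sup>2 \<le> s}" for s
  have D: "D s = (if 0 \<le> s then cball 0 (sqrt s) else {})" for s
    by (auto simp: D_def real_le_rsqrt sqrt_ge_absD dest: order_trans[OF zero_le_power2])
  have eD: "emeasure lborel (D s) = ennreal (unit_ball_vol 2 * max 0 s)" for s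
    by (auto simp: D emeasure_cball max_def)
  have Db: "D s \<in> sets lborel" for s
    by (simp add: D)
  have "norm (t, q) \<in> {1<..2} \<longleftrightarrow> (norm q)\<^sup>2 \<le> 4 - t\<^sup>2 \<and> \<not> (norm q)\<^sup>2 \<le> 1 - t\<^sup>2" for q :: "real \<times> real"
  proof -
    have "norm (t, q) \<le> 2 \<longleftrightarrow> t\<^sup>2 + (norm q)\<^sup>2 \<le> 4"
      using real_sqrt_le_iff[of "t\<^sup>2 + (norm q)\<^sup>2" 4] by (simp add: norm_Pair)
    moreover have "1 < norm (t, q) \<longleftrightarrow> 1 < t\<^sup>2 + (norm q)\<^sup>2"
      by (simp add: norm_Pair)
    ultimately show ?thesis by auto
  qed
  then have "{q :: real \<times> real. norm (t, q) \<in> {1<..2}} = D (4 - t\<^sup>2) - D (1 - t\<^sup>2)"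
    by (auto simp: D_def)
  also have "emeasure lborel \<dots> = emeasure lborel (D (4 - t\<^sup>2)) - emeasure lborel (D (1 - t\<^sup>2))"
  proof (rule emeasure_Diff)
    show "emeasure lborel (D (1 - t\<^sup>2)) \<noteq> \<infinity>" by (simp add: eD)
    show "D (1 - t\<^sup>2) \<subseteq> D (4 - t\<^sup>2)" by (auto simp: D_def)
  qed (use Db in simp_all)
  also have "\<dots> = ennreal (unit_ball_vol 2 * max 0 (4 - t\<^sup>2) - unit_ball_vol 2 * max 0 (1 - t\<^sup>2))"
    unfolding eD by (intro ennreal_minus) simp
  finally show ?thesis by (simp add: right_diff_distrib)
qed

text \<open>The section areas do not increase with the height, whence the inequality, and are
  constant up to height 1, whence the equality: the condition \<open>3 * h \<le> norm w\<close>
  keeps the wider slab in that range.\<close>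

lemma emeasure_annulus_slab:
  fixes w :: "real^3"
  assumes "w \<noteq> 0"
  shows "emeasure lborel {\<xi> \<in> annulus. \<bar>\<xi> \<bullet> w\<bar> \<le> 3 * h} \<le> 3 * emeasure lborel {\<xi> \<in> annulus. \<bar>\<xi> \<bullet> w\<bar> \<le> h}"
    and "3 * h \<le> norm w \<Longrightarrow>
      emeasure lborel {\<xi> \<in> annulus. \<bar>\<xi> \<bullet> w\<bar> \<le> 3 * h} = 3 * emeasure lborel {\<xi> \<in> annulus. \<bar>\<xi> \<bullet> w\<bar> \<le> h}"
proof -
  obtain T :: "real \<times> real \<times> real \<Rightarrow> real^3" where T: "linear T" "\<And>p. norm (T p) = norm p"
    "\<And>t p. T (t, p) \<bullet> w = norm w * t" "distr lborel borel T = lborel"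
    using adapted_frame by blast
  let ?C = "T -` annulus"
  define f where "f t = unit_ball_vol 2 * (max 0 (4 - t\<^sup>2) - max 0 (1 - t\<^sup>2))" for t :: real
  have Cb: "?C \<in> sets borel" by (rule borel_vimage_linear[OF T(1) borel_annulus])
  have slice: "emeasure lborel (Pair t -` ?C) = ennreal (f t)" for t
  proof -
    have "Pair t -` ?C = {q. norm (t, q) \<in> {1<..2}}"
      by (auto simp: annulus_def T(2))
    then show ?thesis by (simp only: emeasure_annulus_slice f_def)
  qed
  have e3: "emeasure lborel {\<xi> \<in> annulus. \<bar>\<xi> \<bullet> w\<bar> \<le> 3 * h}
    = 3 * (\<integral>\<^sup>+t. ennreal (f (3 * t)) * indicator {-(h / norm w)..h / norm w} t \<partial>lborel)"
    unfolding emeasure_slab_frame[OF assms T(1,3,4) borel_annulus]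
    using emeasure_slab_rescale(1)[OF Cb, of "h / norm w"] by (simp add: slice)
  have e1: "emeasure lborel {\<xi> \<in> annulus. \<bar>\<xi> \<bullet> w\<bar> \<le> h}
    = (\<integral>\<^sup>+t. ennreal (f t) * indicator {-(h / norm w)..h / norm w} t \<partial>lborel)"
    unfolding emeasure_slab_frame[OF assms T(1,3,4) borel_annulus]
    using emeasure_slab_rescale(2)[OF Cb, of "h / norm w"] by (simp add: slice)
  have "f (3 * t) \<le> f t" for t
    unfolding f_def by (intro mult_left_mono) (auto simp: max_def power_mult_distrib)
  then show "emeasure lborel {\<xi> \<in> annulus. \<bar>\<xi> \<bullet> w\<bar> \<le> 3 * h} \<le> 3 * emeasure lborel {\<xi> \<in> annulus. \<bar>\<xi> \<bullet> w\<bar> \<le> h}"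
    unfolding e1 e3 by (intro mult_left_mono nn_integral_mono mult_right_mono ennreal_leI) auto
  assume h: "3 * h \<le> norm w"
  have eq: "f (3 * t) = f t" if "t \<in> {-(h / norm w)..h / norm w}" for t
  proof -
    have "3 * (h / norm w) \<le> 1" using h assms by simp
    then have "\<bar>3 * t\<bar> \<le> 1" using that by auto
    then have "(3 * t)\<^sup>2 \<le> 1" by (simp only: abs_square_le_1)
    then have "9 * t\<^sup>2 \<le> 1" by (simp add: power_mult_distrib)
    moreover have "0 \<le> t\<^sup>2" by simp
    ultimately show ?thesis by (simp add: f_def power_mult_distrib)
  qed
  show "emeasure lborel {\<xi> \<in> annulus. \<bar>\<xi> \<bullet> w\<bar> \<le> 3 * h} = 3 * emeasure lborel {\<xi> \<in> annulus. \<bar>\<xi> \<bullet> w\<bar> \<le> h}"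
    unfolding e1 e3 by (intro arg_cong[where f="(*) 3"] nn_integral_cong) (auto simp: indicator_def eq)
qed

lemma content_annulus_pos: "0 < measure lborel annulus"
proof -
  have "emeasure lborel annulus = emeasure lborel (cball (0 :: real^3) 2) - emeasure lborel (cball (0 :: real^3) 1)"
    unfolding annulus_def by (intro emeasure_Diff) (auto simp: emeasure_cball)
  also have "\<dots> = ennreal (unit_ball_vol 3 * 2 ^ 3 - unit_ball_vol 3 * 1 ^ 3)"
    by (simp add: emeasure_cball ennreal_minus)
  finally show ?thesis
    by (simp add: measure_def)
qed

lemma emeasure_annulus_finite: "emeasure lborel annulus < \<infinity>"
  by (rule emeasure_bounded_finite) (auto simp: annulus_def intro: bounded_subset[OF bounded_cball])

text \<open>A substitute for minus the second derivative of the Dirac measure.\<close>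

definition slab_kernel :: "real \<Rightarrow> real \<Rightarrow> real" where
  "slab_kernel e a = indicator {-e..e} a - indicator {-(3 * e)..3 * e} a / 3"

lemma slab_kernel_measurable [measurable]: "slab_kernel e \<in> borel_measurable borel"
  unfolding slab_kernel_def by measurable

lemma slab_kernel_minus [simp]: "slab_kernel e (- a) = slab_kernel e a"
  by (auto simp: slab_kernel_def indicator_def)

lemma abs_slab_kernel_le: "\<bar>slab_kernel e a\<bar> \<le> 1"
  by (auto simp: slab_kernel_def indicator_def)

text \<open>A shift by \<open>t\<close> alters the kernel only within distance \<bar>t\<bar> of one
  of its four jumps.\<close>

lemma abs_slab_kernel_diff_le:
  "\<bar>slab_kernel e (a - t) - slab_kernel e a\<bar> \<le> indicator {c. \<bar>c - e\<bar> \<le> \<bar>t\<bar>} a + indicator {c. \<bar>c - (- e)\<bar> \<le> \<bar>t\<bar>} a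
    + indicator {c. \<bar>c - 3 * e\<bar> \<le> \<bar>t\<bar>} a + indicator {c. \<bar>c - (- 3 * e)\<bar> \<le> \<bar>t\<bar>} a"
proof -
  have "\<bar>indicator {-h..h} (a - t) - indicator {-h..h} a :: real\<bar>
      \<le> indicator {c. \<bar>c - h\<bar> \<le> \<bar>t\<bar>} a + indicator {c. \<bar>c - (- h)\<bar> \<le> \<bar>t\<bar>} a" for h
    by (auto simp: indicator_def)
  from this[of e] this[of "3 * e"] show ?thesis
    unfolding slab_kernel_def by (simp add: abs_le_iff)
qed

section \<open>Section functions smoothed by the slab kernel\<close>

definition smooth_section :: "'a::euclidean_space set \<Rightarrow> real \<Rightarrow> 'a \<Rightarrow> real \<Rightarrow> real" where
  "smooth_section A e \<xi> t = (\<integral>y. indicator A y * slab_kernel e (y \<bullet> \<xi> - t) \<partial>lborel)"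

context
  fixes A :: "'a::euclidean_space set" and e :: real
  assumes A [measurable]: "A \<in> sets borel" and fin: "emeasure lborel A < \<infinity>"
begin

lemma integrable_smooth_section: "integrable lborel (\<lambda>y. indicator A y * slab_kernel e (y \<bullet> \<xi> - t))"
proof (rule Bochner_Integration.integrable_bound)
  show "integrable lborel (indicator A :: 'a \<Rightarrow> real)"
    using fin by (simp add: integrable_indicator_iff)
  show "AE y in lborel. norm (indicator A y * slab_kernel e (y \<bullet> \<xi> - t)) \<le> norm (indicator A y :: real)"
    using abs_slab_kernel_le[of e] by (auto simp: indicator_def)
qed measurable

lemma smooth_section_eq:
  "smooth_section A e \<xi> t = measure lborel {y \<in> A. \<bar>y \<bullet> \<xi> - t\<bar> \<le> e}
    - measure lborel {y \<in> A. \<bar>y \<bullet> \<xi> - t\<bar> \<le> 3 * e} / 3"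
proof -
  have S: "{y \<in> A. \<bar>y \<bullet> \<xi> - t\<bar> \<le> h} \<in> sets borel" for h
    using sets.Int[OF A borel_slab[of \<xi> t h]] by (simp add: Int_def)
  have f: "emeasure lborel {y \<in> A. \<bar>y \<bullet> \<xi> - t\<bar> \<le> h} < \<infinity>" for h
    using emeasure_mono[of "{y \<in> A. \<bar>y \<bullet> \<xi> - t\<bar> \<le> h}" A lborel] A fin by (auto intro: le_less_trans)
  have eq: "indicator A y * slab_kernel e (y \<bullet> \<xi> - t) = indicator {y \<in> A. \<bar>y \<bullet> \<xi> - t\<bar> \<le> e} y
    - indicator {y \<in> A. \<bar>y \<bullet> \<xi> - t\<bar> \<le> 3 * e} y / 3" for y
    by (auto simp: slab_kernel_def indicator_def)
  show ?thesis
    unfolding smooth_section_def eq using S f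
    by (subst Bochner_Integration.integral_diff) (auto simp: integrable_indicator_iff)
qed

lemma abs_smooth_section_le: "\<bar>smooth_section A e \<xi> t\<bar> \<le> measure lborel A"
proof -
  have "\<bar>smooth_section A e \<xi> t\<bar> \<le> (\<integral>y. \<bar>indicator A y * slab_kernel e (y \<bullet> \<xi> - t)\<bar> \<partial>lborel)"
    unfolding smooth_section_def by (rule integral_abs_bound)
  also have "\<dots> \<le> (\<integral>y. indicator A y \<partial>lborel)"
  proof (rule integral_mono)
    show "integrable lborel (indicator A :: 'a \<Rightarrow> real)"
      using fin by (simp add: integrable_indicator_iff)
    show "\<bar>indicator A y * slab_kernel e (y \<bullet> \<xi> - t)\<bar> \<le> indicator A y" for y
      using abs_slab_kernel_le[of e] by (auto simp: indicator_def)
  qed (intro integrable_abs integrable_smooth_section)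
  finally show ?thesis by simp
qed

lemma smooth_section_measurable:
  "(\<lambda>p. smooth_section A e (fst p) (snd p)) \<in> borel_measurable (borel \<Otimes>\<^sub>M borel)"
  unfolding smooth_section_def by measurable

end

subsection \<open>A mollifier that is a superposition of plane waves\<close>

lemma emeasure_subset_cball:
  fixes A :: "'a::euclidean_space set"
  assumes "A \<subseteq> cball 0 \<rho>"
  shows "emeasure lborel A < \<infinity>"
  by (rule emeasure_bounded_finite) (rule bounded_subset[OF bounded_cball assms])

text \<open>Brunn's theorem in the form needed: the nonnegative sign of this weight is what allows
  the inequality between mean logarithms to be multiplied by it.\<close>

lemma smooth_section_0_nonneg:
  fixes K :: "(real^3) set"
  assumes K: "compact K" "convex K" and sym: "\<And>y. y \<in> K \<Longrightarrow> - y \<in> K" and "\<xi> \<noteq> 0"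
  shows "0 \<le> smooth_section K e \<xi> 0"
proof -
  have fin: "emeasure lborel {y \<in> K. \<bar>y \<bullet> \<xi>\<bar> \<le> h} < \<infinity>" for h
    using emeasure_bounded_finite[of "{y \<in> K. \<bar>y \<bullet> \<xi>\<bar> \<le> h}"] compact_imp_bounded[OF K(1)]
    by (auto intro: bounded_subset)
  have "ennreal (measure lborel {y \<in> K. \<bar>y \<bullet> \<xi>\<bar> \<le> 3 * e}) \<le> ennreal (3 * measure lborel {y \<in> K. \<bar>y \<bullet> \<xi>\<bar> \<le> e})"
    using emeasure_central_slab[OF assms, of e] fin
    by (simp add: emeasure_eq_ennreal_measure less_top ennreal_mult)
  then have "measure lborel {y \<in> K. \<bar>y \<bullet> \<xi>\<bar> \<le> 3 * e} \<le> 3 * measure lborel {y \<in> K. \<bar>y \<bullet> \<xi>\<bar> \<le> e}"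
    by simp
  then show ?thesis
    using K(1) fin[of "0"] emeasure_bounded_finite[OF compact_imp_bounded[OF K(1)]]
    by (subst smooth_section_eq) (auto intro: borel_compact)
qed

text \<open>The kernel jumps, but integration over \<open>A\<close> smooths it: a shift affects only
  four slabs of half-width \<bar>t\<bar>, each of volume at most 8 \<rho>^2 \<bar>t\<bar> because
  \<open>norm \<xi>\<close> is at least 1. Hence the constant 32, which does not depend on
  \<open>e\<close>.\<close>

lemma smooth_section_lipschitz:
  fixes A :: "(real^3) set"
  assumes A [measurable]: "A \<in> sets borel" and sub: "A \<subseteq> cball 0 \<rho>" "0 \<le> \<rho>" and \<xi>: "1 \<le> norm \<xi>"
  shows "\<bar>smooth_section A e \<xi> t - smooth_section A e \<xi> 0\<bar> \<le> 32 * \<rho>\<^sup>2 * \<bar>t\<bar>"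
proof -
  have fin: "emeasure lborel A < \<infinity>" by (rule emeasure_subset_cball[OF sub(1)])
  define S where "S s = {y. norm y \<le> \<rho> \<and> \<bar>y \<bullet> \<xi> - s\<bar> \<le> \<bar>t\<bar>}" for s
  have Sb [measurable]: "S s \<in> sets borel" for s
    unfolding S_def by (intro borel_closed closed_Collect_conj closed_Collect_le continuous_intros)
  have Sfin: "emeasure lborel (S s) < \<infinity>" for s
    by (rule emeasure_subset_cball[of _ \<rho>]) (auto simp: S_def)
  have "measure lborel (S s) \<le> 8 * \<rho>\<^sup>2 * \<bar>t\<bar>" for s
  proof -
    have "ennreal (measure lborel (S s)) = emeasure lborel (S s)"
      using Sfin[of s] by (simp add: emeasure_eq_ennreal_measure less_top)
    also have "\<dots> \<le> ennreal (8 * \<rho>\<^sup>2 * \<bar>t\<bar> / norm \<xi>)"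
      unfolding S_def using \<xi> sub(2) by (intro emeasure_slab_le) auto
    also have "\<dots> \<le> ennreal (8 * \<rho>\<^sup>2 * \<bar>t\<bar>)"
    proof (rule ennreal_leI)
      have "0 < norm \<xi>" using \<xi> by linarith
      then show "8 * \<rho>\<^sup>2 * \<bar>t\<bar> / norm \<xi> \<le> 8 * \<rho>\<^sup>2 * \<bar>t\<bar>"
        using divide_left_mono[of 1 "norm \<xi>" "8 * \<rho>\<^sup>2 * \<bar>t\<bar>"] \<xi> by simp
    qed
    finally show ?thesis by simp
  qed
  note Sle = this
  have Sint: "integrable lborel (indicator (S s) :: real^3 \<Rightarrow> real)" for s
    using Sfin by (simp add: integrable_indicator_iff)
  have int: "integrable lborel (\<lambda>y. indicator A y * slab_kernel e (y \<bullet> \<xi> - t))" for t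
    by (rule integrable_smooth_section[OF A fin])
  have "\<bar>smooth_section A e \<xi> t - smooth_section A e \<xi> 0\<bar>
    = \<bar>\<integral>y. indicator A y * slab_kernel e (y \<bullet> \<xi> - t) - indicator A y * slab_kernel e (y \<bullet> \<xi> - 0) \<partial>lborel\<bar>"
    unfolding smooth_section_def by (subst Bochner_Integration.integral_diff[OF int int]) simp
  also have "\<dots> \<le> (\<integral>y. \<bar>indicator A y * slab_kernel e (y \<bullet> \<xi> - t) - indicator A y * slab_kernel e (y \<bullet> \<xi> - 0)\<bar> \<partial>lborel)"
    by (rule integral_abs_bound)
  also have "\<dots> \<le> (\<integral>y. indicator (S e) y + indicator (S (- e)) y + indicator (S (3 * e)) y + indicator (S (- 3 * e)) y \<partial>lborel)"
  proof (rule integral_mono)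
    fix y :: "real^3"
    show "\<bar>indicator A y * slab_kernel e (y \<bullet> \<xi> - t) - indicator A y * slab_kernel e (y \<bullet> \<xi> - 0)\<bar>
      \<le> indicator (S e) y + indicator (S (- e)) y + indicator (S (3 * e)) y + indicator (S (- 3 * e)) y"
    proof (cases "y \<in> A")
      case True
      then have "norm y \<le> \<rho>" using sub(1) by auto
      then show ?thesis
        using True abs_slab_kernel_diff_le[of e "y \<bullet> \<xi>" t] by (simp add: S_def indicator_def)
    qed (auto simp: indicator_def)
  qed (intro integrable_abs Bochner_Integration.integrable_diff Bochner_Integration.integrable_add int Sint)+
  also have "\<dots> = measure lborel (S e) + measure lborel (S (- e)) + measure lborel (S (3 * e)) + measure lborel (S (- 3 * e))"
    using Sint by simp
  also have "\<dots> \<le> 32 * \<rho>\<^sup>2 * \<bar>t\<bar>"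
    using Sle[of e] Sle[of "- e"] Sle[of "3 * e"] Sle[of "- 3 * e"] by simp
  finally show ?thesis .
qed

lemma smooth_section_eq_0:
  fixes A :: "(real^3) set"
  assumes "A \<subseteq> cball 0 \<rho>" "norm \<xi> \<le> 2" "0 \<le> e" "2 * \<rho> + 3 * e < \<bar>t\<bar>"
  shows "smooth_section A e \<xi> t = 0"
proof -
  have "indicator A y * slab_kernel e (y \<bullet> \<xi> - t) = 0" for y
  proof (cases "y \<in> A")
    case True
    have "\<bar>y \<bullet> \<xi>\<bar> \<le> norm y * norm \<xi>" by (rule Cauchy_Schwarz_ineq2)
    also have "\<dots> \<le> \<rho> * 2"
    proof (rule mult_mono)
      show "norm y \<le> \<rho>" using True assms(1) by auto
      then show "0 \<le> \<rho>" using norm_ge_zero[of y] by linarith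
    qed (use assms in auto)
    finally show ?thesis
      using assms by (auto simp: slab_kernel_def indicator_def)
  qed simp
  then show ?thesis
    unfolding smooth_section_def by (simp only: Bochner_Integration.integral_zero)
qed

lemma lborel_integral_scaleR:
  fixes f :: "'a::euclidean_space \<Rightarrow> real"
  assumes [measurable]: "f \<in> borel_measurable borel" and "c \<noteq> 0"
  shows "(\<integral>x. f x \<partial>lborel) = \<bar>c\<bar> ^ DIM('a) * (\<integral>x. f (c *\<^sub>R x) \<partial>lborel)"
  by (subst lborel_affine[OF assms(2), of 0]) (simp add: integral_density integral_distr)

lemma smooth_section_minus:
  fixes A :: "'a::euclidean_space set"
  assumes [measurable]: "A \<in> sets borel" and sym: "\<And>y. y \<in> A \<Longrightarrow> - y \<in> A"
  shows "smooth_section A e \<xi> (- t) = smooth_section A e \<xi> t"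
proof -
  have ind: "indicator A (- y) = (indicator A y :: real)" for y
    using sym[of y] sym[of "- y"] by (auto simp: indicator_def)
  have "smooth_section A e \<xi> t = (\<integral>y. indicator A ((-1) *\<^sub>R y) * slab_kernel e (((-1) *\<^sub>R y) \<bullet> \<xi> - t) \<partial>lborel)"
    unfolding smooth_section_def by (subst lborel_integral_scaleR[where c="-1"]) auto
  also have "\<dots> = (\<integral>y. indicator A y * slab_kernel e (y \<bullet> \<xi> - (- t)) \<partial>lborel)"
    using slab_kernel_minus[of e "_ \<bullet> \<xi> + t"] by (simp add: ind)
  finally show ?thesis by (simp add: smooth_section_def)
qed

text \<open>Point and direction exchange roles: the set is now the annulus of \<xi> and
  \<open>w\<close> acts as the direction, so this is the superposition of the plane waves
  \<open>slab_kernel e (\<xi> \<bullet> w)\<close>, and the facts about section functions apply to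
  it.\<close>

definition mollifier :: "real \<Rightarrow> real^3 \<Rightarrow> real" where
  "mollifier e w = smooth_section annulus e w 0"

definition mollifier_mass :: "real \<Rightarrow> real" where
  "mollifier_mass e = (\<integral>w. mollifier e w \<partial>lborel)"

lemma mollifier_measurable [measurable]: "mollifier e \<in> borel_measurable borel"
proof -
  have "(\<lambda>w. smooth_section annulus e (fst (w, 0 :: real)) (snd (w, 0 :: real))) \<in> borel_measurable borel"
    by (rule measurable_compose[OF _ smooth_section_measurable[OF borel_annulus emeasure_annulus_finite]])
      measurable
  then show ?thesis by (simp add: mollifier_def[abs_def])
qed

lemma annulus_slab_finite: "emeasure lborel {\<xi> \<in> annulus. P \<xi>} < \<infinity>"
  by (rule emeasure_bounded_finite) (auto simp: annulus_def intro: bounded_subset[OF bounded_cball[of 0 2]])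

lemma mollifier_eq:
  "mollifier e w = measure lborel {\<xi> \<in> annulus. \<bar>\<xi> \<bullet> w\<bar> \<le> e} - measure lborel {\<xi> \<in> annulus. \<bar>\<xi> \<bullet> w\<bar> \<le> 3 * e} / 3"
  using smooth_section_eq[OF borel_annulus emeasure_annulus_finite, of e w 0] by (simp add: mollifier_def)

text \<open>Close to the origin both slabs contain the whole annulus, leaving the factor 1 - 1/3.
  This bounds the total mass away from zero.\<close>

lemma mollifier_center:
  assumes "norm w \<le> e / 2"
  shows "mollifier e w = 2 / 3 * measure lborel annulus"
proof -
  have "\<bar>\<xi> \<bullet> w\<bar> \<le> e" if "\<xi> \<in> annulus" for \<xi>
  proof -
    have "\<bar>\<xi> \<bullet> w\<bar> \<le> norm \<xi> * norm w" by (rule Cauchy_Schwarz_ineq2)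
    also have "\<dots> \<le> 2 * (e / 2)"
      using that assms by (intro mult_mono) (auto simp: annulus_def)
    finally show ?thesis by simp
  qed
  moreover have "0 \<le> e" using assms norm_ge_zero[of w] by linarith
  ultimately have "{\<xi> \<in> annulus. \<bar>\<xi> \<bullet> w\<bar> \<le> e} = annulus" "{\<xi> \<in> annulus. \<bar>\<xi> \<bullet> w\<bar> \<le> 3 * e} = annulus"
    by (auto intro: order_trans[where y=e])
  then show ?thesis by (simp add: mollifier_eq)
qed

lemma mollifier_nonneg:
  assumes "0 < e"
  shows "0 \<le> mollifier e w"
proof (cases "w = 0")
  case True
  then have "mollifier e w = 2 / 3 * measure lborel annulus"
    using assms by (intro mollifier_center) simp
  then show ?thesis using content_annulus_pos by linarith
next
  case False
  have "ennreal (measure lborel {\<xi> \<in> annulus. \<bar>\<xi> \<bullet> w\<bar> \<le> 3 * e}) \<le> ennreal (3 * measure lborel {\<xi> \<in> annulus. \<bar>\<xi> \<bullet> w\<bar> \<le> e})"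
    using emeasure_annulus_slab(1)[OF False, of e] annulus_slab_finite
    by (simp add: emeasure_eq_ennreal_measure less_top ennreal_mult)
  then have "measure lborel {\<xi> \<in> annulus. \<bar>\<xi> \<bullet> w\<bar> \<le> 3 * e} \<le> 3 * measure lborel {\<xi> \<in> annulus. \<bar>\<xi> \<bullet> w\<bar> \<le> e}"
    by simp
  then show ?thesis by (simp add: mollifier_eq)
qed

text \<open>The compact support: at this distance both slabs stay where the annulus has constant
  section area, so their volumes are in the exact ratio 3 and the two parts of the kernel
  cancel.\<close>

lemma mollifier_eq_0:
  assumes "0 < e" "3 * e \<le> norm w"
  shows "mollifier e w = 0"
proof -
  have "w \<noteq> 0" using assms by auto
  then have "ennreal (measure lborel {\<xi> \<in> annulus. \<bar>\<xi> \<bullet> w\<bar> \<le> 3 * e}) = ennreal (3 * measure lborel {\<xi> \<in> annulus. \<bar>\<xi> \<bullet> w\<bar> \<le> e})"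
    using emeasure_annulus_slab(2)[OF _ assms(2)] annulus_slab_finite
    by (simp add: emeasure_eq_ennreal_measure less_top ennreal_mult)
  then have "measure lborel {\<xi> \<in> annulus. \<bar>\<xi> \<bullet> w\<bar> \<le> 3 * e} = 3 * measure lborel {\<xi> \<in> annulus. \<bar>\<xi> \<bullet> w\<bar> \<le> e}"
    by (subst (asm) ennreal_inj) auto
  then show ?thesis by (simp add: mollifier_eq)
qed

lemma integrable_mollifier:
  assumes "0 < e"
  shows "integrable lborel (mollifier e)"
proof (rule Bochner_Integration.integrable_bound)
  show "integrable lborel (\<lambda>w. measure lborel annulus * indicator (cball 0 (3 * e)) w :: real)"
    using emeasure_subset_cball[of "cball 0 (3 * e)" "3 * e"]
    by (intro integrable_mult_right) (simp add: integrable_indicator_iff)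
  have "\<bar>mollifier e w\<bar> \<le> measure lborel annulus * indicator (cball 0 (3 * e)) w" for w
  proof (cases "3 * e \<le> norm w")
    case False
    then show ?thesis
      using abs_smooth_section_le[OF borel_annulus emeasure_annulus_finite, of e w 0]
      by (simp add: mollifier_def indicator_def)
  qed (simp add: mollifier_eq_0 assms)
  then show "AE w in lborel. norm (mollifier e w) \<le> norm (measure lborel annulus * indicator (cball 0 (3 * e)) w :: real)"
    by (auto intro: order_trans)
qed simp

lemma mollifier_mass_pos:
  assumes "0 < e"
  shows "0 < mollifier_mass e"
proof -
  have fin: "emeasure lborel (cball (0 :: real^3) (e / 2)) < \<infinity>"
    by (rule emeasure_subset_cball[OF order_refl])
  have "0 < measure lborel (cball (0 :: real^3) (e / 2))"
    using assms by (simp add: content_cball)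
  then have "0 < 2 / 3 * measure lborel annulus * measure lborel (cball (0 :: real^3) (e / 2))"
    using content_annulus_pos by simp
  also have "\<dots> = (\<integral>w. 2 / 3 * measure lborel annulus * indicator (cball 0 (e / 2)) (w :: real^3) \<partial>lborel)"
    by simp
  also have "\<dots> \<le> mollifier_mass e"
    unfolding mollifier_mass_def
  proof (rule integral_mono)
    show "integrable lborel (\<lambda>w. 2 / 3 * measure lborel annulus * indicator (cball 0 (e / 2)) (w :: real^3))"
      using fin by (intro integrable_mult_right) (simp add: integrable_indicator_iff)
    show "2 / 3 * measure lborel annulus * indicator (cball 0 (e / 2)) w \<le> mollifier e w" for w
      using mollifier_center[of w e] mollifier_nonneg[OF assms, of w] by (auto simp: indicator_def)
  qed (rule integrable_mollifier[OF assms])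
  finally show ?thesis .
qed

section \<open>The indicator of the body convolved with the mollifier\<close>

definition smoothed_indicator :: "(real^3) set \<Rightarrow> real \<Rightarrow> real^3 \<Rightarrow> real" where
  "smoothed_indicator K e z = (\<integral>\<xi>. indicator annulus \<xi> * smooth_section K e \<xi> (z \<bullet> \<xi>) \<partial>lborel)"

text \<open>Fubini over \<open>annulus\<close> and \<open>K\<close>. The form as an integral over
  \<xi> leads to logarithms of linear forms; the convolution is local and leads to the gauge of
  \<open>K\<close>.\<close>

lemma smoothed_indicator_eq:
  assumes K [measurable]: "K \<in> sets borel" and fin: "emeasure lborel K < \<infinity>"
  shows "smoothed_indicator K e z = (\<integral>w. indicator K (z + w) * mollifier e w \<partial>lborel)"
proof -
  define f where "f = (\<lambda>(\<xi>, y). indicator annulus \<xi> * (indicator K y * slab_kernel e (y \<bullet> \<xi> - z \<bullet> \<xi>)) :: real)"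
  have [measurable]: "f \<in> borel_measurable (lborel \<Otimes>\<^sub>M lborel)"
    unfolding f_def by measurable
  have "integrable (lborel \<Otimes>\<^sub>M lborel) f"
  proof (rule Bochner_Integration.integrable_bound)
    have "emeasure (lborel \<Otimes>\<^sub>M lborel) (annulus \<times> K) = emeasure lborel annulus * emeasure lborel K"
      by (rule lborel.emeasure_pair_measure_Times) auto
    also have "\<dots> < \<infinity>"
      using fin emeasure_annulus_finite by (simp add: ennreal_mult_less_top)
    finally show "integrable (lborel \<Otimes>\<^sub>M lborel) (indicator (annulus \<times> K) :: _ \<Rightarrow> real)"
      by (simp add: integrable_indicator_iff)
    show "AE p in lborel \<Otimes>\<^sub>M lborel. norm (f p) \<le> norm (indicator (annulus \<times> K) p :: real)"
      using abs_slab_kernel_le[of e] by (intro AE_I2) (auto simp: f_def indicator_def)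
  qed simp
  then have swap: "(\<integral>y. (\<integral>\<xi>. f (\<xi>, y) \<partial>lborel) \<partial>lborel) = (\<integral>\<xi>. (\<integral>y. f (\<xi>, y) \<partial>lborel) \<partial>lborel)"
    using lborel_pair.Fubini_integral[of "\<lambda>\<xi> y. f (\<xi>, y)"] by simp
  have "smoothed_indicator K e z = (\<integral>\<xi>. (\<integral>y. f (\<xi>, y) \<partial>lborel) \<partial>lborel)"
    by (simp add: smoothed_indicator_def smooth_section_def f_def)
  also note swap[symmetric]
  also have "(\<integral>y. (\<integral>\<xi>. f (\<xi>, y) \<partial>lborel) \<partial>lborel) = (\<integral>y. indicator K y * mollifier e (y - z) \<partial>lborel)"
  proof -
    have "(\<integral>\<xi>. f (\<xi>, y) \<partial>lborel) = (\<integral>\<xi>. indicator K y * (indicator annulus \<xi> * slab_kernel e (\<xi> \<bullet> (y - z) - 0)) \<partial>lborel)" for y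
      by (intro Bochner_Integration.integral_cong) (auto simp: f_def inner_diff_right inner_commute)
    then show ?thesis by (simp add: mollifier_def smooth_section_def)
  qed
  also have "\<dots> = (\<integral>y. indicator K y * mollifier e (y - z) \<partial>distr lborel borel ((+) z))"
    by (simp add: lborel_distr_plus)
  also have "\<dots> = (\<integral>w. indicator K (z + w) * mollifier e w \<partial>lborel)"
    by (subst integral_distr) auto
  finally show ?thesis .
qed

context
  fixes K :: "(real^3) set" and e :: real
  assumes K [measurable]: "K \<in> sets borel" and fin: "emeasure lborel K < \<infinity>" and e: "0 < e"
begin

lemma integrable_smoothed_indicator: "integrable lborel (\<lambda>w. indicator K (z + w) * mollifier e w)"
  by (rule Bochner_Integration.integrable_bound[OF integrable_mollifier[OF e]])
    (auto simp: indicator_def)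

lemma smoothed_indicator_nonneg: "0 \<le> smoothed_indicator K e z"
  unfolding smoothed_indicator_eq[OF K fin]
  by (intro integral_nonneg_AE AE_I2) (simp add: mollifier_nonneg e)

lemma smoothed_indicator_le: "smoothed_indicator K e z \<le> mollifier_mass e"
  unfolding smoothed_indicator_eq[OF K fin] mollifier_mass_def
  by (intro integral_mono integrable_smoothed_indicator integrable_mollifier e)
    (auto simp: indicator_def mollifier_nonneg e)

lemma smoothed_indicator_inside:
  assumes "\<And>w. norm w < 3 * e \<Longrightarrow> z + w \<in> K"
  shows "smoothed_indicator K e z = mollifier_mass e"
proof -
  have "indicator K (z + w) * mollifier e w = mollifier e w" for w
    using assms[of w] mollifier_eq_0[OF e, of w] by (cases "norm w < 3 * e") auto
  then show ?thesis
    unfolding smoothed_indicator_eq[OF K fin] mollifier_mass_def by (rule Bochner_Integration.integral_cong[OF refl])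
qed

lemma smoothed_indicator_outside:
  assumes "\<And>w. norm w < 3 * e \<Longrightarrow> z + w \<notin> K"
  shows "smoothed_indicator K e z = 0"
proof -
  have "indicator K (z + w) * mollifier e w = 0" for w
    using assms[of w] mollifier_eq_0[OF e, of w] by (cases "norm w < 3 * e") auto
  then show ?thesis
    unfolding smoothed_indicator_eq[OF K fin] by (simp only: Bochner_Integration.integral_zero)
qed

lemma smoothed_indicator_measurable [measurable]: "smoothed_indicator K e \<in> borel_measurable borel"
proof -
  have [measurable]: "(\<lambda>p. smooth_section K e (fst p) (snd p)) \<in> borel_measurable (borel \<Otimes>\<^sub>M borel)"
    by (rule smooth_section_measurable[OF K fin])
  have "(\<lambda>p. indicator annulus (snd p) * (\<lambda>p. smooth_section K e (fst p) (snd p)) (snd p, fst p \<bullet> snd p))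
      \<in> borel_measurable (borel \<Otimes>\<^sub>M (lborel :: (real^3) measure))"
    by measurable
  then show ?thesis
    unfolding smoothed_indicator_def[abs_def]
    by (intro lborel.borel_measurable_lebesgue_integral) (simp add: case_prod_beta')
qed

end

subsection \<open>Integrability of logarithms of linear forms\<close>

text \<open>The logarithm counts scales: if \<bar>a\<bar> = exp (- s) with s > 0, every n < s
  contributes 1, and there are at least s such n. The singularity thus becomes a sum over slabs
  whose volumes decay geometrically. Large values are covered by the term \<bar>a\<bar>, and a = 0
  by \<open>ln 0 = 0\<close>.\<close>

lemma abs_ln_le_suminf:
  fixes a :: real
  shows "ennreal \<bar>ln \<bar>a\<bar>\<bar> \<le> ennreal \<bar>a\<bar> + (\<Sum>n. indicator {c. \<bar>c\<bar> \<le> exp (- real n)} a)"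
proof (cases "a = 0 \<or> 1 \<le> \<bar>a\<bar>")
  case True
  then have "\<bar>ln \<bar>a\<bar>\<bar> \<le> \<bar>a\<bar>"
    using ln_le_minus_one[of "\<bar>a\<bar>"] by (cases "a = 0") auto
  then have "ennreal \<bar>ln \<bar>a\<bar>\<bar> \<le> ennreal \<bar>a\<bar>" by (rule ennreal_leI)
  then show ?thesis by (rule order_trans) simp
next
  case False
  define s where "s = - ln \<bar>a\<bar>"
  have s: "0 < s" "\<bar>a\<bar> = exp (- s)"
    using False by (auto simp: s_def)
  define N where "N = nat \<lceil>s\<rceil>"
  have N: "s \<le> real N" unfolding N_def by linarith
  have lt: "real n < s" if "n < N" for n
    using that unfolding N_def by linarith
  then have one: "indicator {c. \<bar>c\<bar> \<le> exp (- real n)} a = (1 :: ennreal)" if "n < N" for n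
    using lt[OF that] s(2) by (auto simp: indicator_def)
  have "ennreal \<bar>ln \<bar>a\<bar>\<bar> \<le> ennreal (real N)"
    using N s(1) by (intro ennreal_leI) (simp add: s_def)
  also have "\<dots> = (\<Sum>n<N. indicator {c. \<bar>c\<bar> \<le> exp (- real n)} a)"
    using one by (simp add: ennreal_of_nat_eq_real_of_nat)
  also have "\<dots> \<le> (\<Sum>n. indicator {c. \<bar>c\<bar> \<le> exp (- real n)} a)"
    by (intro sum_le_suminf) auto
  finally show ?thesis by (rule order_trans) simp
qed

lemma summable_exp_minus: "summable (\<lambda>n. exp (- real n))"
proof -
  have "exp (- real n) = exp (- 1 :: real) ^ n" for n
    by (simp add: exp_of_nat_mult[symmetric])
  then show ?thesis by (simp add: summable_geometric)
qed

text \<open>Here \<open>r\<close> stands for the norm of \<xi>. The first summand bounds the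
  integral of \<bar>y \<bullet> \<xi>\<bar> over the ball, the second adds up the slabs of
  half-widths exp (- n).\<close>

definition ln_bound :: "real \<Rightarrow> real \<Rightarrow> real" where
  "ln_bound \<rho> r = r * \<rho> * measure lborel (cball (0 :: real^3) \<rho>) + 8 * \<rho>\<^sup>2 / r * (\<Sum>n. exp (- real n))"

lemma nn_integral_abs_ln_le:
  fixes \<xi> :: "real^3"
  assumes "\<xi> \<noteq> 0" "0 \<le> \<rho>"
  shows "(\<integral>\<^sup>+y. indicator (cball 0 \<rho>) y * ennreal \<bar>ln \<bar>y \<bullet> \<xi>\<bar>\<bar> \<partial>lborel) \<le> ennreal (ln_bound \<rho> (norm \<xi>))"
proof -
  define S where "S n = {y. norm y \<le> \<rho> \<and> \<bar>y \<bullet> \<xi> - 0\<bar> \<le> exp (- real n)}" for n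
  have [measurable]: "cball (0 :: real^3) \<rho> \<in> sets borel" by simp
  have [measurable]: "S n \<in> sets borel" for n
    unfolding S_def by (intro borel_closed closed_Collect_conj closed_Collect_le continuous_intros)
  have "(\<integral>\<^sup>+y. indicator (cball 0 \<rho>) y * ennreal \<bar>ln \<bar>y \<bullet> \<xi>\<bar>\<bar> \<partial>lborel)
    \<le> (\<integral>\<^sup>+y. ennreal (norm \<xi> * \<rho>) * indicator (cball 0 \<rho>) y + (\<Sum>n. indicator (S n) y) \<partial>lborel)"
  proof (rule nn_integral_mono)
    fix y :: "real^3"
    show "indicator (cball 0 \<rho>) y * ennreal \<bar>ln \<bar>y \<bullet> \<xi>\<bar>\<bar>
      \<le> ennreal (norm \<xi> * \<rho>) * indicator (cball 0 \<rho>) y + (\<Sum>n. indicator (S n) y)"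
    proof (cases "norm y \<le> \<rho>")
      case True
      have "\<bar>y \<bullet> \<xi>\<bar> \<le> norm y * norm \<xi>" by (rule Cauchy_Schwarz_ineq2)
      also have "\<dots> \<le> \<rho> * norm \<xi>" using True by (intro mult_right_mono) auto
      finally have "ennreal \<bar>y \<bullet> \<xi>\<bar> \<le> ennreal (norm \<xi> * \<rho>)"
        by (intro ennreal_leI) (simp add: mult.commute)
      moreover have "(\<lambda>n. indicator {c. \<bar>c\<bar> \<le> exp (- real n)} (y \<bullet> \<xi>)) = (\<lambda>n. indicator (S n) y :: ennreal)"
        using True by (auto simp: fun_eq_iff S_def indicator_def)
      ultimately show ?thesis
        using True abs_ln_le_suminf[of "y \<bullet> \<xi>"] by (auto intro: order_trans add_right_mono)
    qed simp
  qed
  also have "\<dots> = ennreal (norm \<xi> * \<rho>) * emeasure lborel (cball (0 :: real^3) \<rho>) + (\<Sum>n. emeasure lborel (S n))"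
    by (subst nn_integral_add) (auto simp: nn_integral_cmult_indicator nn_integral_suminf)
  also have "\<dots> \<le> ennreal (norm \<xi> * \<rho>) * emeasure lborel (cball (0 :: real^3) \<rho>)
      + (\<Sum>n. ennreal (8 * \<rho>\<^sup>2 * exp (- real n) / norm \<xi>))"
    unfolding S_def using assms by (intro add_left_mono suminf_le emeasure_slab_le) auto
  also have "(\<Sum>n. ennreal (8 * \<rho>\<^sup>2 * exp (- real n) / norm \<xi>)) = ennreal (8 * \<rho>\<^sup>2 / norm \<xi> * (\<Sum>n. exp (- real n)))"
  proof -
    have "(\<lambda>n. 8 * \<rho>\<^sup>2 * exp (- real n) / norm \<xi>) sums (8 * \<rho>\<^sup>2 / norm \<xi> * (\<Sum>n. exp (- real n)))"
      using sums_mult[OF summable_sums[OF summable_exp_minus], of "8 * \<rho>\<^sup>2 / norm \<xi>"] by simp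
    then show ?thesis
      by (subst suminf_ennreal2) (auto simp: sums_iff)
  qed
  also have "ennreal (norm \<xi> * \<rho>) * emeasure lborel (cball (0 :: real^3) \<rho>) = ennreal (norm \<xi> * \<rho> * measure lborel (cball (0 :: real^3) \<rho>))"
    using assms emeasure_subset_cball[of "cball (0 :: real^3) \<rho>" \<rho>]
    by (simp add: emeasure_eq_ennreal_measure less_top ennreal_mult)
  also have "\<dots> + ennreal (8 * \<rho>\<^sup>2 / norm \<xi> * (\<Sum>n. exp (- real n))) = ennreal (ln_bound \<rho> (norm \<xi>))"
    unfolding ln_bound_def using assms suminf_nonneg[OF summable_exp_minus]
    by (intro ennreal_plus[symmetric]) auto
  finally show ?thesis .
qed

lemma integrable_ln_inner:
  fixes \<xi> :: "real^3"
  assumes [measurable]: "A \<in> sets borel" and A: "A \<subseteq> cball 0 \<rho>" "0 \<le> \<rho>" and "\<xi> \<noteq> 0"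
  shows "integrable lborel (\<lambda>y. indicator A y * ln \<bar>y \<bullet> \<xi>\<bar>)"
    and "(\<integral>y. indicator A y * \<bar>ln \<bar>y \<bullet> \<xi>\<bar>\<bar> \<partial>lborel) \<le> ln_bound \<rho> (norm \<xi>)"
proof -
  have le: "(\<integral>\<^sup>+y. ennreal (indicator A y * \<bar>ln \<bar>y \<bullet> \<xi>\<bar>\<bar>) \<partial>lborel) \<le> ennreal (ln_bound \<rho> (norm \<xi>))"
    using A by (intro order_trans[OF nn_integral_mono nn_integral_abs_ln_le[OF assms(4,3)]])
      (auto simp: indicator_def)
  show "integrable lborel (\<lambda>y. indicator A y * ln \<bar>y \<bullet> \<xi>\<bar>)"
    using le by (intro integrableI_bounded) (auto simp: abs_mult intro: le_less_trans)
  show "(\<integral>y. indicator A y * \<bar>ln \<bar>y \<bullet> \<xi>\<bar>\<bar> \<partial>lborel) \<le> ln_bound \<rho> (norm \<xi>)"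
  proof (subst integral_eq_nn_integral)
    have "0 \<le> ln_bound \<rho> (norm \<xi>)"
      using A(2) suminf_nonneg[OF summable_exp_minus] by (simp add: ln_bound_def)
    then show "enn2real (\<integral>\<^sup>+y. ennreal (indicator A y * \<bar>ln \<bar>y \<bullet> \<xi>\<bar>\<bar>) \<partial>lborel) \<le> ln_bound \<rho> (norm \<xi>)"
      using le by (metis enn2real_ennreal enn2real_mono ennreal_less_top)
  qed auto
qed

lemma AE_inner_nonzero:
  fixes \<xi> :: "real^3"
  assumes "\<xi> \<noteq> 0"
  shows "AE y in lborel. y \<bullet> \<xi> \<noteq> 0"
proof -
  have "negligible {y. \<xi> \<bullet> y = 0}" using assms by (intro negligible_hyperplane) auto
  moreover have "{y. \<xi> \<bullet> y = 0} \<in> sets borel" by (intro borel_closed closed_hyperplane)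
  ultimately have "{y. \<xi> \<bullet> y = 0} \<in> null_sets lborel"
    by (auto simp: negligible_iff_null_sets null_sets_completion_iff)
  then show ?thesis
    by (rule AE_I') (auto simp: inner_commute)
qed

subsection \<open>Radial integrals of sections\<close>

locale centered_body =
  fixes K :: "(real^3) set" and \<delta> \<rho> e :: real
  assumes compact: "compact K" and convex: "convex K" and sym: "\<And>y. y \<in> K \<Longrightarrow> - y \<in> K"
    and inner: "cball 0 \<delta> \<subseteq> K" and outer: "K \<subseteq> cball 0 \<rho>"
    and e_pos: "0 < e" and e_less: "3 * e < \<delta>"
begin

lemma borel [measurable]: "K \<in> sets borel"
  using compact by (rule borel_compact)

lemma finite: "emeasure lborel K < \<infinity>"
  using outer by (rule emeasure_subset_cball)

lemma \<delta>_pos: "0 < \<delta>" using e_pos e_less by simp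

lemma zero_mem: "0 \<in> K" using inner \<delta>_pos by auto

lemma \<rho>_nonneg: "0 \<le> \<rho>"
  using zero_mem outer by force

text \<open>The ball of radius 3 e, which carries the mollifier, lies in \<eta> \<open>K\<close>; so
  \<eta> is the relative blur that smoothing causes in the gauge.\<close>

definition \<eta> :: real where "\<eta> = 3 * e / \<delta>"

lemma \<eta>: "0 < \<eta>" "\<eta> < 1"
  using e_pos e_less \<delta>_pos by (auto simp: \<eta>_def)

lemma small_mem: "norm w \<le> 3 * e \<Longrightarrow> (1 / \<eta>) *\<^sub>R w \<in> K"
proof -
  assume w: "norm w \<le> 3 * e"
  have "norm ((1 / \<eta>) *\<^sub>R w) = norm w * \<delta> / (3 * e)"
    using e_pos \<delta>_pos by (simp add: \<eta>_def)
  also have "\<dots> \<le> \<delta>"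
    using w e_pos \<delta>_pos by (simp add: divide_le_eq mult.commute mult_right_mono)
  finally show ?thesis using inner by auto
qed

lemma scale_mem:
  assumes "y \<in> K" "0 \<le> s" "s \<le> 1"
  shows "s *\<^sub>R y \<in> K"
proof -
  have "s *\<^sub>R y + (1 - s) *\<^sub>R 0 \<in> K"
    using assms zero_mem by (intro convexD[OF convex]) auto
  then show ?thesis by simp
qed

text \<open>The sum of (1 - \<eta>) \<open>K\<close> and \<eta> \<open>K\<close> lies in
  \<open>K\<close>, so the mollifier centred at such a point sees only \<open>K\<close>.\<close>

lemma smoothed_indicator_scaled_inside:
  assumes "y \<in> K" "0 \<le> s" "s \<le> 1 - \<eta>"
  shows "smoothed_indicator K e (s *\<^sub>R y) = mollifier_mass e"
proof (rule smoothed_indicator_inside[OF borel finite e_pos])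
  fix w :: "real^3" assume "norm w < 3 * e"
  then have w: "(1 / \<eta>) *\<^sub>R w \<in> K" by (intro small_mem) simp
  have "(s / (1 - \<eta>)) *\<^sub>R y \<in> K"
    using assms \<eta> by (intro scale_mem) auto
  then have "(1 - \<eta>) *\<^sub>R ((s / (1 - \<eta>)) *\<^sub>R y) + \<eta> *\<^sub>R ((1 / \<eta>) *\<^sub>R w) \<in> K"
    using w \<eta> by (intro convexD[OF convex]) auto
  then show "s *\<^sub>R y + w \<in> K" using \<eta> by simp
qed

text \<open>If s x + w were in \<open>K\<close>, then adding - w, an element of \<eta>
  \<open>K\<close>, would put s x into (1 + \<eta>) \<open>K\<close>; shrinking towards the origin
  would then put x / c into \<open>K\<close>.\<close>

lemma smoothed_indicator_scaled_outside:
  assumes "(1 / c) *\<^sub>R x \<notin> K" "0 < c" "(1 + \<eta>) / c \<le> s"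
  shows "smoothed_indicator K e (s *\<^sub>R x) = 0"
proof (rule smoothed_indicator_outside[OF borel finite e_pos], rule notI)
  fix w :: "real^3" assume "norm w < 3 * e" and mem: "s *\<^sub>R x + w \<in> K"
  then have w: "(1 / \<eta>) *\<^sub>R (- w) \<in> K" by (intro small_mem) simp
  have s: "0 < s" using assms(2,3) \<eta> by (auto intro: less_le_trans[of 0 "(1 + \<eta>) / c"])
  have "(1 / (1 + \<eta>)) *\<^sub>R (s *\<^sub>R x + w) + (\<eta> / (1 + \<eta>)) *\<^sub>R ((1 / \<eta>) *\<^sub>R (- w)) \<in> K"
    using mem w \<eta> by (intro convexD[OF convex]) (auto simp: add_divide_distrib[symmetric])
  moreover have "(1 / (1 + \<eta>)) *\<^sub>R (s *\<^sub>R x + w) + (\<eta> / (1 + \<eta>)) *\<^sub>R ((1 / \<eta>) *\<^sub>R (- w)) = (s / (1 + \<eta>)) *\<^sub>R x"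
    using \<eta> by (simp add: scaleR_add_right)
  ultimately have "(s / (1 + \<eta>)) *\<^sub>R x \<in> K" by simp
  then have "((1 + \<eta>) / (s * c)) *\<^sub>R ((s / (1 + \<eta>)) *\<^sub>R x) \<in> K"
  proof (rule scale_mem)
    have "1 + \<eta> \<le> s * c" using assms(2,3) by (simp add: divide_le_eq)
    then show "(1 + \<eta>) / (s * c) \<le> 1" using assms(2) s by (simp add: divide_le_eq)
  qed (use assms(2) s \<eta> in auto)
  moreover have "(1 + \<eta>) / (s * c) * (s / (1 + \<eta>)) = 1 / c"
    using s \<eta> assms by (simp add: divide_simps)
  ultimately show False using assms(1) by (metis scaleR_scaleR)
qed

text \<open>With s = \<alpha> exp \<tau> this integrates the section function at s c against ds / s
  over s \<ge> \<alpha>. The lower cutoff is there because the section function need not vanish at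
  height 0.\<close>

definition radial_integral :: "real \<Rightarrow> real^3 \<Rightarrow> real \<Rightarrow> real" where
  "radial_integral \<alpha> \<xi> c = (\<integral>\<tau>. indicator {0..} \<tau> * smooth_section K e \<xi> (\<alpha> * exp \<tau> * c) \<partial>lborel)"

lemma section_measurable [measurable]:
  assumes [measurable]: "f \<in> measurable M borel" "g \<in> borel_measurable M"
  shows "(\<lambda>x. smooth_section K e (f x) (g x)) \<in> borel_measurable M"
proof -
  have "(\<lambda>x. smooth_section K e (fst (f x, g x)) (snd (f x, g x))) \<in> borel_measurable M"
    by (rule measurable_compose[OF _ smooth_section_measurable[OF borel finite]]) measurable
  then show ?thesis by simp
qed

lemma radial_integral_measurable [measurable]:
  assumes [measurable]: "f \<in> measurable M borel" "g \<in> borel_measurable M"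
  shows "(\<lambda>x. radial_integral \<alpha> (f x) (g x)) \<in> borel_measurable M"
  unfolding radial_integral_def by measurable

text \<open>The \<tau> at which \<alpha> exp \<tau> reaches 2 \<rho> + 3 e: for
  \<open>norm \<xi>\<close> at most 2, planes beyond that height miss \<open>K\<close> even when
  widened by 3 e.\<close>

definition cutoff :: "real \<Rightarrow> real" where
  "cutoff \<alpha> = ln ((2 * \<rho> + 3 * e) / \<alpha>)"

context
  fixes \<alpha> :: real and \<xi> :: "real^3"
  assumes \<alpha>: "0 < \<alpha>" and \<xi>: "\<xi> \<in> annulus"
begin

lemma norm_annulus: "1 < norm \<xi>" "norm \<xi> \<le> 2"
  using \<xi> by (auto simp: annulus_def)

lemma section_vanishes:
  assumes "cutoff \<alpha> < \<tau>"
  shows "smooth_section K e \<xi> (\<alpha> * exp \<tau>) = 0"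
proof (rule smooth_section_eq_0[OF outer norm_annulus(2)])
  have pos: "0 < (2 * \<rho> + 3 * e) / \<alpha>"
    using \<rho>_nonneg e_pos \<alpha> by (intro divide_pos_pos) auto
  have "(2 * \<rho> + 3 * e) / \<alpha> < exp \<tau>"
    using assms pos unfolding cutoff_def by (metis exp_less_cancel_iff exp_ln)
  then show "2 * \<rho> + 3 * e < \<bar>\<alpha> * exp \<tau>\<bar>"
    using \<alpha> by (simp add: divide_less_eq mult.commute)
qed (use e_pos in simp)

lemma abs_section_le: "\<bar>indicator {l..} \<tau> * smooth_section K e \<xi> (\<alpha> * exp \<tau>)\<bar>
    \<le> measure lborel K * indicator {l..cutoff \<alpha>} \<tau>"
  using section_vanishes[of \<tau>] abs_smooth_section_le[OF borel finite, of e \<xi> "\<alpha> * exp \<tau>"]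
  by (cases "\<tau> \<le> cutoff \<alpha>") (auto simp: indicator_def)

lemma integrable_section: "integrable lborel (\<lambda>\<tau>. indicator {l..} \<tau> * smooth_section K e \<xi> (\<alpha> * exp \<tau>))"
proof (rule Bochner_Integration.integrable_bound)
  show "integrable lborel (\<lambda>\<tau>. measure lborel K * indicator {l..cutoff \<alpha>} \<tau>)"
    by (intro integrable_mult_right) (simp add: integrable_indicator_iff emeasure_lborel_Icc_eq)
  show "AE \<tau> in lborel. norm (indicator {l..} \<tau> * smooth_section K e \<xi> (\<alpha> * exp \<tau>))
      \<le> norm (measure lborel K * indicator {l..cutoff \<alpha>} \<tau>)"
    using abs_section_le by (intro AE_I2) (auto intro: order_trans)
qed measurable

lemma section_abs: "smooth_section K e \<xi> (\<alpha> * exp \<tau> * c) = smooth_section K e \<xi> (\<alpha> * exp (\<tau> + ln \<bar>c\<bar>))"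
  if "c \<noteq> 0"
proof -
  have "smooth_section K e \<xi> (\<alpha> * exp \<tau> * c) = smooth_section K e \<xi> (\<alpha> * exp \<tau> * \<bar>c\<bar>)"
    using smooth_section_minus[OF borel sym, of e \<xi> "\<alpha> * exp \<tau> * c"] by (cases "0 \<le> c") auto
  then show ?thesis using that by (simp add: exp_add mult.assoc)
qed

lemma radial_integral_shift:
  assumes "c \<noteq> 0"
  shows "radial_integral \<alpha> \<xi> c = (\<integral>\<tau>. indicator {ln \<bar>c\<bar>..} \<tau> * smooth_section K e \<xi> (\<alpha> * exp \<tau>) \<partial>lborel)"
    and "integrable lborel (\<lambda>\<tau>. indicator {0..} \<tau> * smooth_section K e \<xi> (\<alpha> * exp \<tau> * c))"
proof -
  let ?f = "\<lambda>\<tau>. indicator {ln \<bar>c\<bar>..} \<tau> * smooth_section K e \<xi> (\<alpha> * exp \<tau>)"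
  have eq: "(\<lambda>\<tau>. indicator {0..} \<tau> * smooth_section K e \<xi> (\<alpha> * exp \<tau> * c)) = (\<lambda>\<tau>. ?f (ln \<bar>c\<bar> + 1 * \<tau>))"
    using section_abs[OF assms] by (auto simp: fun_eq_iff indicator_def add.commute)
  show "radial_integral \<alpha> \<xi> c = integral\<^sup>L lborel ?f"
    unfolding radial_integral_def eq by (subst lborel_integral_real_affine[of 1 _ "ln \<bar>c\<bar>"]) auto
  show "integrable lborel (\<lambda>\<tau>. indicator {0..} \<tau> * smooth_section K e \<xi> (\<alpha> * exp \<tau> * c))"
    unfolding eq by (rule lborel_integrable_real_affine[OF integrable_section]) simp
qed

text \<open>The shifted integrand is bounded by the volume of \<open>K\<close> and lives between ln
  \<bar>c\<bar> and the cutoff.\<close>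

lemma abs_radial_integral_le:
  "\<bar>radial_integral \<alpha> \<xi> c\<bar> \<le> measure lborel K * (\<bar>cutoff \<alpha>\<bar> + \<bar>ln \<bar>c\<bar>\<bar>)"
proof (cases "c = 0")
  case True
  \<comment> \<open>For \<open>c = 0\<close> the integrand is constant on a half-line; its infinite
    length has \<open>measure\<close> 0, so the integral takes the default value 0. Together with
    \<open>ln 0 = 0\<close> the bound then holds without an exceptional set.\<close>
  have "emeasure lborel {0 :: real..} = \<infinity>"
  proof (rule ccontr)
    assume "emeasure lborel {0 :: real..} \<noteq> \<infinity>"
    then obtain r where r: "0 \<le> r" "emeasure lborel {0 :: real..} = ennreal r"
      by (metis ennreal_cases infinity_ennreal_def)
    have "emeasure lborel {0..r + 1} \<le> emeasure lborel {0 :: real..}"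
      by (intro emeasure_mono) auto
    then show False using r by simp
  qed
  then have "measure lborel {0 :: real..} = 0"
    by (simp add: measure_def)
  then show ?thesis using True by (simp add: radial_integral_def)
next
  case False
  let ?f = "\<lambda>\<tau>. indicator {ln \<bar>c\<bar>..} \<tau> * smooth_section K e \<xi> (\<alpha> * exp \<tau>)"
  have "\<bar>radial_integral \<alpha> \<xi> c\<bar> \<le> (\<integral>\<tau>. \<bar>?f \<tau>\<bar> \<partial>lborel)"
    unfolding radial_integral_shift(1)[OF False] by (rule integral_abs_bound)
  also have "\<dots> \<le> (\<integral>\<tau>. measure lborel K * indicator {ln \<bar>c\<bar>..cutoff \<alpha>} \<tau> \<partial>lborel)"
    by (intro integral_mono integrable_abs integrable_section abs_section_le integrable_mult_right)
      (simp add: integrable_indicator_iff emeasure_lborel_Icc_eq)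
  also have "\<dots> \<le> measure lborel K * (\<bar>cutoff \<alpha>\<bar> + \<bar>ln \<bar>c\<bar>\<bar>)"
    by (auto intro!: mult_left_mono simp: measure_def emeasure_lborel_Icc_eq)
  finally show ?thesis .
qed

text \<open>The absolute value inside the integral is what exchanging the integrals over \<xi> and
  \<tau> requires.\<close>

lemma integral_abs_section_le:
  assumes "c \<noteq> 0"
  shows "(\<integral>\<tau>. \<bar>indicator {0..} \<tau> * smooth_section K e \<xi> (\<alpha> * exp \<tau> * c)\<bar> \<partial>lborel)
    \<le> measure lborel K * (\<bar>cutoff \<alpha>\<bar> + \<bar>ln \<bar>c\<bar>\<bar>)"
proof -
  let ?f = "\<lambda>\<tau>. indicator {ln \<bar>c\<bar>..} \<tau> * smooth_section K e \<xi> (\<alpha> * exp \<tau>)"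
  have eq: "(\<lambda>\<tau>. indicator {0..} \<tau> * smooth_section K e \<xi> (\<alpha> * exp \<tau> * c)) = (\<lambda>\<tau>. ?f (ln \<bar>c\<bar> + 1 * \<tau>))"
    using section_abs[OF assms] by (auto simp: fun_eq_iff indicator_def add.commute)
  have "(\<integral>\<tau>. \<bar>indicator {0..} \<tau> * smooth_section K e \<xi> (\<alpha> * exp \<tau> * c)\<bar> \<partial>lborel) = (\<integral>\<tau>. \<bar>?f (ln \<bar>c\<bar> + 1 * \<tau>)\<bar> \<partial>lborel)"
    using eq by (simp add: fun_eq_iff)
  also have "\<dots> = (\<integral>\<tau>. \<bar>?f \<tau>\<bar> \<partial>lborel)"
    using lborel_integral_real_affine[of 1 "\<lambda>\<tau>. \<bar>?f \<tau>\<bar>" "ln \<bar>c\<bar>"] by simp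
  also have "\<dots> \<le> (\<integral>\<tau>. measure lborel K * indicator {ln \<bar>c\<bar>..cutoff \<alpha>} \<tau> \<partial>lborel)"
    by (intro integral_mono integrable_abs integrable_section abs_section_le integrable_mult_right)
      (simp add: integrable_indicator_iff emeasure_lborel_Icc_eq)
  also have "\<dots> \<le> measure lborel K * (\<bar>cutoff \<alpha>\<bar> + \<bar>ln \<bar>c\<bar>\<bar>)"
    by (auto intro!: mult_left_mono simp: measure_def emeasure_lborel_Icc_eq)
  finally show ?thesis .
qed

text \<open>In the variable \<open>\<tau> = ln s\<close> the factor \<open>c\<close> acts as the translation by \<open>ln \<bar>c\<bar>\<close>.\<close>

lemma radial_integral_expansion:
  assumes "c \<noteq> 0"
  shows "\<bar>radial_integral \<alpha> \<xi> c - radial_integral \<alpha> \<xi> 1 + smooth_section K e \<xi> 0 * ln \<bar>c\<bar>\<bar>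
    \<le> 32 * \<rho>\<^sup>2 * \<alpha> * (1 + \<bar>c\<bar>) * \<bar>ln \<bar>c\<bar>\<bar>"
proof -
  define l where "l = ln \<bar>c\<bar>"
  define B where "B \<tau> = smooth_section K e \<xi> (\<alpha> * exp \<tau>)" for \<tau>
  define b where "b = smooth_section K e \<xi> 0"
  \<comment> \<open>A signed indicator of the stretch between 0 and \<open>l\<close>, with integral
    exactly \<open>l\<close> for either sign of \<open>l\<close>: the source of the
    logarithm.\<close>
  define D where "D \<tau> = (indicator {0..} \<tau> - indicator {l..} \<tau> :: real)" for \<tau>
  have [measurable]: "D \<in> borel_measurable borel" "B \<in> borel_measurable borel"
    unfolding D_def B_def by measurable
  have D_cases: "D = (if 0 \<le> l then indicator {0..<l} else (\<lambda>\<tau>. - indicator {l..<0} \<tau>))"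
    by (auto simp: D_def fun_eq_iff indicator_def)
  have D: "integrable lborel D" "(\<integral>\<tau>. D \<tau> \<partial>lborel) = l" "(\<integral>\<tau>. \<bar>D \<tau>\<bar> \<partial>lborel) = \<bar>l\<bar>"
    by (auto simp: D_cases integrable_indicator_iff)
  have int: "integrable lborel (\<lambda>\<tau>. indicator {a..} \<tau> * B \<tau>)" for a
    unfolding B_def by (rule integrable_section)
  have DB: "(\<lambda>\<tau>. D \<tau> * B \<tau>) = (\<lambda>\<tau>. indicator {0..} \<tau> * B \<tau> - indicator {l..} \<tau> * B \<tau>)"
    by (auto simp: D_def algebra_simps)
  have intDB: "integrable lborel (\<lambda>\<tau>. D \<tau> * B \<tau>)"
    unfolding DB by (intro Bochner_Integration.integrable_diff int)
  have intDb: "integrable lborel (\<lambda>\<tau>. D \<tau> * b)"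
    using D(1) by simp
  have "radial_integral \<alpha> \<xi> 1 - radial_integral \<alpha> \<xi> c = (\<integral>\<tau>. D \<tau> * B \<tau> \<partial>lborel)"
    unfolding DB using radial_integral_shift(1)[OF assms] radial_integral_shift(1)[of 1] int
    by (simp add: B_def l_def Bochner_Integration.integral_diff)
  moreover have "(\<integral>\<tau>. D \<tau> * B \<tau> - D \<tau> * b \<partial>lborel) = (\<integral>\<tau>. D \<tau> * B \<tau> \<partial>lborel) - l * b"
    using Bochner_Integration.integral_diff[OF intDB intDb] D(2) by simp
  ultimately have "radial_integral \<alpha> \<xi> c - radial_integral \<alpha> \<xi> 1 + b * l = - (\<integral>\<tau>. D \<tau> * B \<tau> - D \<tau> * b \<partial>lborel)"
    by (simp add: mult.commute)
  then have "\<bar>radial_integral \<alpha> \<xi> c - radial_integral \<alpha> \<xi> 1 + b * l\<bar> \<le> (\<integral>\<tau>. \<bar>D \<tau> * B \<tau> - D \<tau> * b\<bar> \<partial>lborel)"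
    by (simp add: integral_abs_bound)
  also have "\<dots> \<le> (\<integral>\<tau>. (32 * \<rho>\<^sup>2 * \<alpha> * (1 + \<bar>c\<bar>)) * \<bar>D \<tau>\<bar> \<partial>lborel)"
  proof (rule integral_mono)
    fix \<tau>
    show "\<bar>D \<tau> * B \<tau> - D \<tau> * b\<bar> \<le> (32 * \<rho>\<^sup>2 * \<alpha> * (1 + \<bar>c\<bar>)) * \<bar>D \<tau>\<bar>"
    proof (cases "D \<tau> = 0")
      case False
      \<comment> \<open>On the support of \<open>D\<close> the height \<alpha> exp \<tau> is at most
        \<alpha> (1 + \<bar>c\<bar>), so the Lipschitz bound compares \<open>B \<tau>\<close> with
        its limit \<open>b\<close> at an error of order \<alpha>.\<close>
      then have "\<tau> \<le> 0 \<or> \<tau> \<le> l"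
        by (auto simp: D_def indicator_def split: if_splits)
      then have "exp \<tau> \<le> 1 \<or> exp \<tau> \<le> \<bar>c\<bar>"
        using assms by (auto simp: l_def) (metis exp_le_cancel_iff exp_ln zero_less_abs_iff)
      then have "exp \<tau> \<le> 1 + \<bar>c\<bar>" by (elim disjE) linarith+
      have "\<bar>B \<tau> - b\<bar> \<le> 32 * \<rho>\<^sup>2 * \<bar>\<alpha> * exp \<tau>\<bar>"
        unfolding B_def b_def using norm_annulus \<rho>_nonneg outer by (intro smooth_section_lipschitz borel) auto
      also have "\<dots> \<le> 32 * \<rho>\<^sup>2 * (\<alpha> * (1 + \<bar>c\<bar>))"
        using \<alpha> \<open>exp \<tau> \<le> 1 + \<bar>c\<bar>\<close> by (intro mult_left_mono) (auto simp: abs_mult)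
      finally have "\<bar>D \<tau>\<bar> * \<bar>B \<tau> - b\<bar> \<le> \<bar>D \<tau>\<bar> * (32 * \<rho>\<^sup>2 * (\<alpha> * (1 + \<bar>c\<bar>)))"
        by (intro mult_left_mono) auto
      moreover have "\<bar>D \<tau> * B \<tau> - D \<tau> * b\<bar> = \<bar>D \<tau>\<bar> * \<bar>B \<tau> - b\<bar>"
        by (simp only: right_diff_distrib[symmetric] abs_mult)
      ultimately show ?thesis
        by (simp add: algebra_simps)
    qed simp
  qed (intro integrable_abs Bochner_Integration.integrable_diff intDB intDb integrable_mult_right D(1))+
  also have "\<dots> = 32 * \<rho>\<^sup>2 * \<alpha> * (1 + \<bar>c\<bar>) * \<bar>l\<bar>"
    using D(3) by simp
  finally show ?thesis by (simp add: b_def l_def)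
qed

end

end

subsection \<open>The logarithmic potential of a convex body\<close>

text \<open>\<open>ln_bound\<close> made uniform over the annulus: norm 2 in the term that grows
  with the norm, norm 1 in the term that decays.\<close>

definition annulus_ln_bound :: "real \<Rightarrow> real" where
  "annulus_ln_bound \<rho> = 2 * \<rho> * measure lborel (cball (0 :: real^3) \<rho>) + 8 * \<rho>\<^sup>2 * (\<Sum>n. exp (- real n))"

lemma ln_bound_annulus:
  assumes "\<xi> \<in> annulus" "0 \<le> \<rho>"
  shows "ln_bound \<rho> (norm \<xi>) \<le> annulus_ln_bound \<rho>"
proof -
  have n: "1 < norm \<xi>" "norm \<xi> \<le> 2" using assms by (auto simp: annulus_def)
  have "0 < norm \<xi>" using n by linarith
  then have "8 * \<rho>\<^sup>2 / norm \<xi> \<le> 8 * \<rho>\<^sup>2"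
    using divide_left_mono[of 1 "norm \<xi>" "8 * \<rho>\<^sup>2"] n by auto
  moreover have "norm \<xi> * \<rho> \<le> 2 * \<rho>" using n assms by (intro mult_right_mono) auto
  ultimately show ?thesis
    unfolding ln_bound_def annulus_ln_bound_def using suminf_nonneg[OF summable_exp_minus]
    by (intro add_mono mult_right_mono[where c="measure lborel _"] mult_right_mono[where c="suminf _"]) auto
qed

lemma annulus_ln_bound_nonneg: "0 \<le> \<rho> \<Longrightarrow> 0 \<le> annulus_ln_bound \<rho>"
  using suminf_nonneg[OF summable_exp_minus] by (simp add: annulus_ln_bound_def)

text \<open>The majorant for Fubini in \<open>x\<close> and \<xi>. Integrating over \<open>x\<close>
  first works because the bound for fixed \<xi> is uniform over the annulus.\<close>

lemma integrable_prod_abs_ln: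
  fixes X :: "(real^3) set"
  assumes [measurable]: "X \<in> sets borel" and X: "X \<subseteq> cball 0 r" "0 \<le> r"
  shows "integrable (lborel \<Otimes>\<^sub>M lborel) (\<lambda>(x, \<xi>). indicator X x * (indicator annulus \<xi> * \<bar>ln \<bar>x \<bullet> \<xi>\<bar>\<bar>) :: real)"
proof (rule integrableI_bounded)
  have "(\<integral>\<^sup>+p. ennreal (norm ((\<lambda>(x, \<xi>). indicator X x * (indicator annulus \<xi> * \<bar>ln \<bar>x \<bullet> \<xi>\<bar>\<bar>) :: real) p)) \<partial>(lborel \<Otimes>\<^sub>M lborel))
    = (\<integral>\<^sup>+\<xi>. (\<integral>\<^sup>+x. ennreal (indicator X x * (indicator annulus \<xi> * \<bar>ln \<bar>x \<bullet> \<xi>\<bar>\<bar>)) \<partial>lborel) \<partial>lborel)"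
    by (subst lborel_pair.nn_integral_snd[symmetric]) (auto simp: abs_mult split_beta')
  also have "\<dots> \<le> (\<integral>\<^sup>+\<xi>. ennreal (annulus_ln_bound r) * indicator annulus \<xi> \<partial>lborel)"
  proof (rule nn_integral_mono)
    fix \<xi> :: "real^3"
    show "(\<integral>\<^sup>+x. ennreal (indicator X x * (indicator annulus \<xi> * \<bar>ln \<bar>x \<bullet> \<xi>\<bar>\<bar>)) \<partial>lborel)
      \<le> ennreal (annulus_ln_bound r) * indicator annulus \<xi>"
    proof (cases "\<xi> \<in> annulus")
      case True
      have "(\<integral>\<^sup>+x. ennreal (indicator X x * (indicator annulus \<xi> * \<bar>ln \<bar>x \<bullet> \<xi>\<bar>\<bar>)) \<partial>lborel)
        \<le> (\<integral>\<^sup>+x. indicator (cball 0 r) x * ennreal \<bar>ln \<bar>x \<bullet> \<xi>\<bar>\<bar> \<partial>lborel)"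
        using X(1) True by (intro nn_integral_mono) (auto simp: indicator_def)
      also have "\<dots> \<le> ennreal (annulus_ln_bound r)"
        using nn_integral_abs_ln_le[OF annulus_nonzero[OF True] X(2)]
          ennreal_leI[OF ln_bound_annulus[OF True X(2)]] by (rule order_trans)
      finally show ?thesis using True by simp
    qed simp
  qed
  also have "\<dots> < \<infinity>"
    using emeasure_annulus_finite by (simp add: nn_integral_cmult_indicator ennreal_mult_less_top)
  finally show "(\<integral>\<^sup>+p. ennreal (norm ((\<lambda>(x, \<xi>). indicator X x * (indicator annulus \<xi> * \<bar>ln \<bar>x \<bullet> \<xi>\<bar>\<bar>) :: real) p)) \<partial>(lborel \<Otimes>\<^sub>M lborel)) < \<infinity>" .
qed measurable

context centered_body
begin

text \<open>A regularised logarithm of the gauge: for nonzero x, while \<alpha> times the gauge of x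
  is at most 1 - \<eta>, it equals minus the mollifier mass times the logarithm of that product, up
  to an error between the mass times ln (1 - \<eta>) and the mass times ln (1 + \<eta>).\<close>

definition log_potential :: "real \<Rightarrow> real^3 \<Rightarrow> real" where
  "log_potential \<alpha> x = (\<integral>\<xi>. indicator annulus \<xi> * radial_integral \<alpha> \<xi> (x \<bullet> \<xi>) \<partial>lborel)"

lemma log_potential_measurable [measurable]: "log_potential \<alpha> \<in> borel_measurable borel"
  unfolding log_potential_def by measurable

lemma finite_prod_annulus:
  assumes [measurable]: "X \<in> sets borel" and X: "X \<subseteq> cball 0 r"
  shows "integrable (lborel \<Otimes>\<^sub>M lborel) (indicator (X \<times> annulus) :: (real^3) \<times> (real^3) \<Rightarrow> real)"
proof -
  have "emeasure (lborel \<Otimes>\<^sub>M lborel) (X \<times> annulus) = emeasure lborel X * emeasure lborel annulus"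
    by (rule lborel.emeasure_pair_measure_Times) auto
  also have "\<dots> < \<infinity>"
    using emeasure_subset_cball[OF X] emeasure_annulus_finite by (simp add: ennreal_mult_less_top)
  finally show ?thesis by (simp add: integrable_indicator_iff)
qed

lemma integrable_prod_radial:
  assumes [measurable]: "X \<in> sets borel" and X: "X \<subseteq> cball 0 r" "0 \<le> r" and \<alpha>: "0 < \<alpha>"
  shows "integrable (lborel \<Otimes>\<^sub>M lborel) (\<lambda>(x, \<xi>). indicator X x * (indicator annulus \<xi> * radial_integral \<alpha> \<xi> (x \<bullet> \<xi>)))"
proof (rule Bochner_Integration.integrable_bound)
  let ?v = "measure lborel K"
  show "integrable (lborel \<Otimes>\<^sub>M lborel) (\<lambda>p. ?v * \<bar>cutoff \<alpha>\<bar> * indicator (X \<times> annulus) p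
      + ?v * (\<lambda>(x, \<xi>). indicator X x * (indicator annulus \<xi> * \<bar>ln \<bar>x \<bullet> \<xi>\<bar>\<bar>)) p)"
    by (intro Bochner_Integration.integrable_add integrable_mult_right finite_prod_annulus[OF _ X(1)] integrable_prod_abs_ln[OF _ X]) auto
  have "\<bar>indicator X x * (indicator annulus \<xi> * radial_integral \<alpha> \<xi> (x \<bullet> \<xi>))\<bar>
    \<le> ?v * \<bar>cutoff \<alpha>\<bar> * indicator (X \<times> annulus) (x, \<xi>) + ?v * (indicator X x * (indicator annulus \<xi> * \<bar>ln \<bar>x \<bullet> \<xi>\<bar>\<bar>))" for x \<xi>
    using abs_radial_integral_le[OF \<alpha>, of \<xi> "x \<bullet> \<xi>"] by (auto simp: indicator_def algebra_simps)
  then show "AE p in lborel \<Otimes>\<^sub>M lborel. norm ((\<lambda>(x, \<xi>). indicator X x * (indicator annulus \<xi> * radial_integral \<alpha> \<xi> (x \<bullet> \<xi>))) p)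
    \<le> norm (?v * \<bar>cutoff \<alpha>\<bar> * indicator (X \<times> annulus) p
      + ?v * (\<lambda>(x, \<xi>). indicator X x * (indicator annulus \<xi> * \<bar>ln \<bar>x \<bullet> \<xi>\<bar>\<bar>)) p)"
    by (intro AE_I2) (auto simp: split_beta' intro: order_trans)
qed measurable

lemma
  assumes X: "X \<in> sets borel" "X \<subseteq> cball 0 r" "0 \<le> r" and \<alpha>: "0 < \<alpha>"
  shows integrable_log_potential: "integrable lborel (\<lambda>x. indicator X x * log_potential \<alpha> x)"
    and integrable_annulus_radial: "integrable lborel (\<lambda>\<xi>. indicator annulus \<xi> * (\<integral>x. indicator X x * radial_integral \<alpha> \<xi> (x \<bullet> \<xi>) \<partial>lborel))"
    and integral_log_potential: "(\<integral>x. indicator X x * log_potential \<alpha> x \<partial>lborel)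
      = (\<integral>\<xi>. indicator annulus \<xi> * (\<integral>x. indicator X x * radial_integral \<alpha> \<xi> (x \<bullet> \<xi>) \<partial>lborel) \<partial>lborel)"
proof -
  let ?f = "\<lambda>x \<xi>. indicator X x * (indicator annulus \<xi> * radial_integral \<alpha> \<xi> (x \<bullet> \<xi>))"
  have int: "integrable (lborel \<Otimes>\<^sub>M lborel) (\<lambda>(x, \<xi>). ?f x \<xi>)"
    by (rule integrable_prod_radial[OF X \<alpha>])
  have 1: "(\<integral>\<xi>. ?f x \<xi> \<partial>lborel) = indicator X x * log_potential \<alpha> x" for x
    by (simp add: log_potential_def)
  have 2: "(\<integral>x. ?f x \<xi> \<partial>lborel) = indicator annulus \<xi> * (\<integral>x. indicator X x * radial_integral \<alpha> \<xi> (x \<bullet> \<xi>) \<partial>lborel)" for \<xi>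
    by (simp add: mult.left_commute)
  show "integrable lborel (\<lambda>x. indicator X x * log_potential \<alpha> x)"
    using lborel_pair.integrable_fst[OF int] unfolding 1 .
  show "integrable lborel (\<lambda>\<xi>. indicator annulus \<xi> * (\<integral>x. indicator X x * radial_integral \<alpha> \<xi> (x \<bullet> \<xi>) \<partial>lborel))"
    using lborel_pair.integrable_snd[OF int] unfolding 2 .
  show "(\<integral>x. indicator X x * log_potential \<alpha> x \<partial>lborel)
      = (\<integral>\<xi>. indicator annulus \<xi> * (\<integral>x. indicator X x * radial_integral \<alpha> \<xi> (x \<bullet> \<xi>) \<partial>lborel) \<partial>lborel)"
    using lborel_pair.Fubini_integral[OF int] unfolding 1 2 by simp
qed

text \<open>Exchanging \<xi> and \<tau> turns the plane waves into the smoothed indicator along the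
  ray through \<open>x\<close>. The majorant is a logarithm in \<xi> for fixed \<open>x\<close>,
  integrable over the annulus by the bound for linear forms with point and direction
  exchanged.\<close>

lemma log_potential_eq:
  assumes \<alpha>: "0 < \<alpha>" and x: "x \<noteq> 0"
  shows "log_potential \<alpha> x = (\<integral>\<tau>. indicator {0..} \<tau> * smoothed_indicator K e ((\<alpha> * exp \<tau>) *\<^sub>R x) \<partial>lborel)"
proof -
  let ?f = "\<lambda>\<xi> \<tau>. indicator annulus \<xi> * (indicator {0..} \<tau> * smooth_section K e \<xi> (\<alpha> * exp \<tau> * (x \<bullet> \<xi>)))"
  let ?v = "measure lborel K"
  have nz: "AE \<xi> in lborel. x \<bullet> \<xi> \<noteq> 0"
    using AE_inner_nonzero[OF x] by (simp add: inner_commute)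
  have int: "integrable (lborel \<Otimes>\<^sub>M lborel) (\<lambda>(\<xi>, \<tau>). ?f \<xi> \<tau>)"
  proof (rule lborel_pair.Fubini_integrable)
    show "AE \<xi> in lborel. integrable lborel (\<lambda>\<tau>. (\<lambda>(\<xi>, \<tau>). ?f \<xi> \<tau>) (\<xi>, \<tau>))"
      using nz
    proof eventually_elim
      case (elim \<xi>)
      then show ?case
        using radial_integral_shift(2)[OF \<alpha>, of \<xi> "x \<bullet> \<xi>"] by (cases "\<xi> \<in> annulus") auto
    qed
    show "integrable lborel (\<lambda>\<xi>. \<integral>\<tau>. norm ((\<lambda>(\<xi>, \<tau>). ?f \<xi> \<tau>) (\<xi>, \<tau>)) \<partial>lborel)"
    proof (rule Bochner_Integration.integrable_bound)
      show "integrable lborel (\<lambda>\<xi>. ?v * \<bar>cutoff \<alpha>\<bar> * indicator annulus \<xi> + ?v * \<bar>indicator annulus \<xi> * ln \<bar>\<xi> \<bullet> x\<bar>\<bar>)"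
        using emeasure_annulus_finite
        by (intro Bochner_Integration.integrable_add integrable_mult_right integrable_abs integrable_ln_inner(1)[of _ 2] x)
          (auto simp: integrable_indicator_iff annulus_def)
      show "AE \<xi> in lborel. norm (\<integral>\<tau>. norm ((\<lambda>(\<xi>, \<tau>). ?f \<xi> \<tau>) (\<xi>, \<tau>)) \<partial>lborel)
        \<le> norm (?v * \<bar>cutoff \<alpha>\<bar> * indicator annulus \<xi> + ?v * \<bar>indicator annulus \<xi> * ln \<bar>\<xi> \<bullet> x\<bar>\<bar>)"
        using nz
      proof eventually_elim
        case (elim \<xi>)
        show ?case
        proof (cases "\<xi> \<in> annulus")
          case True
          have "norm (\<integral>\<tau>. norm ((\<lambda>(\<xi>, \<tau>). ?f \<xi> \<tau>) (\<xi>, \<tau>)) \<partial>lborel)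
            = (\<integral>\<tau>. \<bar>indicator {0..} \<tau> * smooth_section K e \<xi> (\<alpha> * exp \<tau> * (x \<bullet> \<xi>))\<bar> \<partial>lborel)"
            using True by simp
          also have "\<dots> \<le> ?v * (\<bar>cutoff \<alpha>\<bar> + \<bar>ln \<bar>x \<bullet> \<xi>\<bar>\<bar>)"
            by (rule integral_abs_section_le[OF \<alpha> True elim])
          also have "\<dots> = norm (?v * \<bar>cutoff \<alpha>\<bar> * indicator annulus \<xi> + ?v * \<bar>indicator annulus \<xi> * ln \<bar>\<xi> \<bullet> x\<bar>\<bar>)"
            using True by (simp add: inner_commute distrib_left)
          finally show ?thesis .
        qed simp
      qed
    qed measurable
  qed measurable
  have "log_potential \<alpha> x = (\<integral>\<xi>. (\<integral>\<tau>. ?f \<xi> \<tau> \<partial>lborel) \<partial>lborel)"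
    by (simp add: log_potential_def radial_integral_def)
  also have "\<dots> = (\<integral>\<tau>. (\<integral>\<xi>. ?f \<xi> \<tau> \<partial>lborel) \<partial>lborel)"
    using lborel_pair.Fubini_integral[OF int] by simp
  also have "\<dots> = (\<integral>\<tau>. indicator {0..} \<tau> * smoothed_indicator K e ((\<alpha> * exp \<tau>) *\<^sub>R x) \<partial>lborel)"
  proof -
    have "(\<integral>\<xi>. ?f \<xi> \<tau> \<partial>lborel) = (\<integral>\<xi>. indicator {0..} \<tau> * (indicator annulus \<xi> * smooth_section K e \<xi> (((\<alpha> * exp \<tau>) *\<^sub>R x) \<bullet> \<xi>)) \<partial>lborel)" for \<tau>
      by (intro Bochner_Integration.integral_cong) (auto simp: mult_ac)
    then show ?thesis by (simp add: smoothed_indicator_def)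
  qed
  finally show ?thesis .
qed

section \<open>The potential against the gauge: bounds and exact scaling\<close>

abbreviation "mass \<equiv> mollifier_mass e"

lemma mass_nonneg: "0 \<le> mass"
  using mollifier_mass_pos[OF e_pos] by simp

lemma radial_smoothed_outside:
  assumes "0 < \<alpha>" "0 < c" "(1 / c) *\<^sub>R x \<notin> K" "ln ((1 + \<eta>) / (\<alpha> * c)) < \<tau>"
  shows "smoothed_indicator K e ((\<alpha> * exp \<tau>) *\<^sub>R x) = 0"
proof (rule smoothed_indicator_scaled_outside[OF assms(3,2)])
  have "0 < (1 + \<eta>) / (\<alpha> * c)" using assms \<eta> by simp
  then have "(1 + \<eta>) / (\<alpha> * c) < exp \<tau>"
    using assms(4) by (metis exp_less_cancel_iff exp_ln)
  then show "(1 + \<eta>) / c \<le> \<alpha> * exp \<tau>"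
    using assms by (simp add: field_simps)
qed

lemma radial_smoothed_inside:
  assumes "0 < \<alpha>" "0 < c" "(1 / c) *\<^sub>R x \<in> K" "\<tau> \<le> ln ((1 - \<eta>) / (\<alpha> * c))"
  shows "smoothed_indicator K e ((\<alpha> * exp \<tau>) *\<^sub>R x) = mass"
proof -
  have "0 < (1 - \<eta>) / (\<alpha> * c)" using assms \<eta> by simp
  then have "exp \<tau> \<le> (1 - \<eta>) / (\<alpha> * c)"
    using assms(4) by (metis exp_le_cancel_iff exp_ln)
  then have "\<alpha> * exp \<tau> * c \<le> 1 - \<eta>"
    using assms by (simp add: field_simps)
  then have "smoothed_indicator K e ((\<alpha> * exp \<tau> * c) *\<^sub>R ((1 / c) *\<^sub>R x)) = mass"
    using assms by (intro smoothed_indicator_scaled_inside) auto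
  then show ?thesis using assms(2) by simp
qed

lemma exists_outside:
  assumes "x \<noteq> 0"
  obtains c where "0 < c" "(1 / c) *\<^sub>R x \<notin> K"
proof
  show "0 < norm x / (\<rho> + 1)" using assms \<rho>_nonneg by simp
  have "norm ((1 / (norm x / (\<rho> + 1))) *\<^sub>R x) = \<rho> + 1"
    using assms \<rho>_nonneg by simp
  then show "(1 / (norm x / (\<rho> + 1))) *\<^sub>R x \<notin> K"
    using outer by force
qed

lemma integrable_radial_smoothed:
  assumes \<alpha>: "0 < \<alpha>" and x: "x \<noteq> 0"
  shows "integrable lborel (\<lambda>\<tau>. indicator {l..} \<tau> * smoothed_indicator K e ((\<alpha> * exp \<tau>) *\<^sub>R x))"
proof -
  obtain c where c: "0 < c" "(1 / c) *\<^sub>R x \<notin> K" using exists_outside[OF x] .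
  let ?t = "ln ((1 + \<eta>) / (\<alpha> * c))"
  note [measurable] = smoothed_indicator_measurable[OF borel finite e_pos]
  show ?thesis
  proof (rule Bochner_Integration.integrable_bound)
    show "integrable lborel (\<lambda>\<tau>. mass * indicator {l..?t} \<tau>)"
      by (intro integrable_mult_right) (simp add: integrable_indicator_iff emeasure_lborel_Icc_eq)
    have "\<bar>indicator {l..} \<tau> * smoothed_indicator K e ((\<alpha> * exp \<tau>) *\<^sub>R x)\<bar> \<le> mass * indicator {l..?t} \<tau>" for \<tau>
      using radial_smoothed_outside[OF \<alpha> c, of \<tau>] smoothed_indicator_le[OF borel finite e_pos]
        smoothed_indicator_nonneg[OF borel finite e_pos]
      by (cases "\<tau> \<le> ?t") (auto simp: indicator_def)
    then show "AE \<tau> in lborel. norm (indicator {l..} \<tau> * smoothed_indicator K e ((\<alpha> * exp \<tau>) *\<^sub>R x)) \<le> norm (mass * indicator {l..?t} \<tau>)"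
      by (intro AE_I2) (simp only: real_norm_def, rule order_trans[OF _ abs_ge_self])
  qed measurable
qed

text \<open>Along the ray the smoothed indicator is at most \<open>mass\<close>, and it vanishes
  beyond the stated logarithm. The condition \<open>\<alpha> * c \<le> 1\<close> makes that
  logarithm nonnegative, hence equal to the length of the remaining interval.\<close>

lemma log_potential_le:
  assumes \<alpha>: "0 < \<alpha>" and x: "x \<noteq> 0" and c: "0 < c" "(1 / c) *\<^sub>R x \<notin> K" "\<alpha> * c \<le> 1"
  shows "log_potential \<alpha> x \<le> mass * ln ((1 + \<eta>) / (\<alpha> * c))"
proof -
  let ?t = "ln ((1 + \<eta>) / (\<alpha> * c))"
  have "1 \<le> (1 + \<eta>) / (\<alpha> * c)" using \<alpha> c \<eta> by (simp add: le_divide_eq)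
  then have t: "0 \<le> ?t" by simp
  have "log_potential \<alpha> x \<le> (\<integral>\<tau>. mass * indicator {0..?t} \<tau> \<partial>lborel)"
    unfolding log_potential_eq[OF \<alpha> x]
  proof (rule integral_mono[OF integrable_radial_smoothed[OF \<alpha> x]])
    show "integrable lborel (\<lambda>\<tau>. mass * indicator {0..?t} \<tau>)"
      by (intro integrable_mult_right) (simp add: integrable_indicator_iff emeasure_lborel_Icc_eq)
    show "indicator {0..} \<tau> * smoothed_indicator K e ((\<alpha> * exp \<tau>) *\<^sub>R x) \<le> mass * indicator {0..?t} \<tau>" for \<tau>
      using radial_smoothed_outside[OF \<alpha> c(1,2), of \<tau>] smoothed_indicator_le[OF borel finite e_pos]
      by (cases "\<tau> \<le> ?t") (auto simp: indicator_def)
  qed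
  also have "\<dots> = mass * ?t" using t by simp
  finally show ?thesis .
qed

lemma log_potential_ge:
  assumes \<alpha>: "0 < \<alpha>" and x: "x \<noteq> 0" and c: "0 < c" "(1 / c) *\<^sub>R x \<in> K" "\<alpha> * c \<le> 1 - \<eta>"
  shows "mass * ln ((1 - \<eta>) / (\<alpha> * c)) \<le> log_potential \<alpha> x"
proof -
  let ?t = "ln ((1 - \<eta>) / (\<alpha> * c))"
  have "1 \<le> (1 - \<eta>) / (\<alpha> * c)" using \<alpha> c \<eta> by (simp add: le_divide_eq)
  then have t: "0 \<le> ?t" by simp
  have "mass * ?t = (\<integral>\<tau>. mass * indicator {0..?t} \<tau> \<partial>lborel)" using t by simp
  also have "\<dots> \<le> log_potential \<alpha> x"
    unfolding log_potential_eq[OF \<alpha> x]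
  proof (rule integral_mono[OF _ integrable_radial_smoothed[OF \<alpha> x]])
    show "integrable lborel (\<lambda>\<tau>. mass * indicator {0..?t} \<tau>)"
      by (intro integrable_mult_right) (simp add: integrable_indicator_iff emeasure_lborel_Icc_eq)
    show "mass * indicator {0..?t} \<tau> \<le> indicator {0..} \<tau> * smoothed_indicator K e ((\<alpha> * exp \<tau>) *\<^sub>R x)" for \<tau>
      using radial_smoothed_inside[OF \<alpha> c(1,2), of \<tau>] smoothed_indicator_nonneg[OF borel finite e_pos]
      by (auto simp: indicator_def)
  qed
  finally show ?thesis .
qed

text \<open>Scaling is exact, with no error from the blur \<eta>: dilation by \<open>c\<close>
  shifts \<tau> by ln c and loses the stretch from 0 to ln c, where \<alpha> exp \<tau> \<le> 1 -
  \<eta> and the smoothed indicator still has its full value.\<close>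

lemma log_potential_scale:
  assumes \<alpha>: "0 < \<alpha>" and x: "x \<noteq> 0" "x \<in> K" and c: "1 \<le> c" "\<alpha> * c \<le> 1 - \<eta>"
  shows "log_potential \<alpha> (c *\<^sub>R x) = log_potential \<alpha> x - mass * ln c"
proof -
  let ?W = "\<lambda>\<tau>. smoothed_indicator K e ((\<alpha> * exp \<tau>) *\<^sub>R x)"
  have c0: "0 < c" "0 \<le> ln c" using c by auto
  have "log_potential \<alpha> (c *\<^sub>R x) = (\<integral>\<tau>. indicator {ln c..} (ln c + 1 * \<tau>) * ?W (ln c + 1 * \<tau>) \<partial>lborel)"
    using c0 x \<alpha> by (subst log_potential_eq) (auto simp: indicator_def exp_add mult_ac intro!: Bochner_Integration.integral_cong)
  also have "\<dots> = (\<integral>\<tau>. indicator {ln c..} \<tau> * ?W \<tau> \<partial>lborel)"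
    using lborel_integral_real_affine[of 1 "\<lambda>\<tau>. indicator {ln c..} \<tau> * ?W \<tau>" "ln c"] by simp
  also have "\<dots> = (\<integral>\<tau>. indicator {0..} \<tau> * ?W \<tau> - mass * indicator {0..<ln c} \<tau> \<partial>lborel)"
  proof (rule Bochner_Integration.integral_cong)
    fix \<tau>
    have "?W \<tau> = mass" if "\<tau> < ln c"
    proof (rule radial_smoothed_inside[OF \<alpha>, of 1])
      have "c \<le> (1 - \<eta>) / (\<alpha> * 1)" using c \<alpha> by (simp add: le_divide_eq mult.commute)
      then have "ln c \<le> ln ((1 - \<eta>) / (\<alpha> * 1))" using c0 by (intro ln_mono) auto
      then show "\<tau> \<le> ln ((1 - \<eta>) / (\<alpha> * 1))" using that by linarith
    qed (use x in auto)
    then show "indicator {ln c..} \<tau> * ?W \<tau> = indicator {0..} \<tau> * ?W \<tau> - mass * indicator {0..<ln c} \<tau>"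
    proof (cases "\<tau> < ln c")
      case False
      then have "0 \<le> \<tau>" "ln c \<le> \<tau>" using c0 by linarith+
      then show ?thesis by (simp add: indicator_def)
    qed (auto simp: indicator_def)
  qed simp
  also have "\<dots> = log_potential \<alpha> x - mass * ln c"
    using integrable_radial_smoothed[OF \<alpha> x(1), of 0] c0
    by (subst Bochner_Integration.integral_diff) (auto simp: log_potential_eq[OF \<alpha> x(1)] integrable_indicator_iff)
  finally show ?thesis .
qed

text \<open>The pointwise expansion integrated over \<open>X\<close>, where \<bar>x \<bullet>
  \<xi>\<bar> \<le> 2 r. Only the logarithmic term retains the dependence on \<open>x\<close>, and
  the error vanishes with \<alpha>.\<close>

lemma integral_radial_expansion:
  assumes X [measurable]: "X \<in> sets borel" and sub: "X \<subseteq> cball 0 r" "0 \<le> r" and \<alpha>: "0 < \<alpha>" and \<xi>: "\<xi> \<in> annulus"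
  shows "\<bar>(\<integral>x. indicator X x * radial_integral \<alpha> \<xi> (x \<bullet> \<xi>) \<partial>lborel) - measure lborel X * radial_integral \<alpha> \<xi> 1
      + smooth_section K e \<xi> 0 * (\<integral>x. indicator X x * ln \<bar>x \<bullet> \<xi>\<bar> \<partial>lborel)\<bar>
    \<le> 32 * \<rho>\<^sup>2 * \<alpha> * (1 + 2 * r) * annulus_ln_bound r"
proof -
  define b where "b = smooth_section K e \<xi> 0"
  define C where "C = radial_integral \<alpha> \<xi> 1"
  define M where "M = 32 * \<rho>\<^sup>2 * \<alpha> * (1 + 2 * r)"
  have M: "0 \<le> M" using \<alpha> sub by (simp add: M_def)
  have nz: "\<xi> \<noteq> 0" using \<xi> by (rule annulus_nonzero)
  note ln = integrable_ln_inner[OF X sub nz]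
  have Xint: "integrable lborel (indicator X :: real^3 \<Rightarrow> real)"
    using emeasure_subset_cball[OF sub(1)] by (simp add: integrable_indicator_iff)
  let ?v = "measure lborel K"
  have abs_ind: "\<bar>indicator X x * ln \<bar>x \<bullet> \<xi>\<bar>\<bar> = indicator X x * \<bar>ln \<bar>x \<bullet> \<xi>\<bar>\<bar>" for x
    by (simp add: abs_mult)
  have absln: "integrable lborel (\<lambda>x. indicator X x * \<bar>ln \<bar>x \<bullet> \<xi>\<bar>\<bar>)"
    using integrable_abs[OF ln(1)] unfolding abs_ind .
  have G: "integrable lborel (\<lambda>x. indicator X x * radial_integral \<alpha> \<xi> (x \<bullet> \<xi>))"
  proof (rule Bochner_Integration.integrable_bound)
    show "integrable lborel (\<lambda>x. ?v * \<bar>cutoff \<alpha>\<bar> * indicator X x + ?v * (indicator X x * \<bar>ln \<bar>x \<bullet> \<xi>\<bar>\<bar>))"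
      by (intro Bochner_Integration.integrable_add integrable_mult_right Xint absln)
    have "\<bar>indicator X x * radial_integral \<alpha> \<xi> (x \<bullet> \<xi>)\<bar> \<le> ?v * \<bar>cutoff \<alpha>\<bar> * indicator X x + ?v * (indicator X x * \<bar>ln \<bar>x \<bullet> \<xi>\<bar>\<bar>)" for x
      using abs_radial_integral_le[OF \<alpha> \<xi>, of "x \<bullet> \<xi>"] by (auto simp: indicator_def algebra_simps)
    then show "AE x in lborel. norm (indicator X x * radial_integral \<alpha> \<xi> (x \<bullet> \<xi>))
        \<le> norm (?v * \<bar>cutoff \<alpha>\<bar> * indicator X x + ?v * (indicator X x * \<bar>ln \<bar>x \<bullet> \<xi>\<bar>\<bar>))"
      by (intro AE_I2) (auto intro: order_trans)
  qed measurable
  let ?E = "\<lambda>x. indicator X x * radial_integral \<alpha> \<xi> (x \<bullet> \<xi>) - C * indicator X x + b * (indicator X x * ln \<bar>x \<bullet> \<xi>\<bar>)"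
  have E: "integrable lborel ?E"
    by (intro Bochner_Integration.integrable_add Bochner_Integration.integrable_diff integrable_mult_right G Xint ln(1))
  have ae: "AE x in lborel. \<bar>?E x\<bar> \<le> M * (indicator X x * \<bar>ln \<bar>x \<bullet> \<xi>\<bar>\<bar>)"
    using AE_inner_nonzero[OF nz]
  proof eventually_elim
    case (elim x)
    show ?case
    proof (cases "x \<in> X")
      case True
      have "\<bar>x \<bullet> \<xi>\<bar> \<le> norm x * norm \<xi>" by (rule Cauchy_Schwarz_ineq2)
      also have "\<dots> \<le> r * 2"
      proof (rule mult_mono)
        show "norm x \<le> r" using True sub(1) by auto
        show "norm \<xi> \<le> 2" using \<xi> by (simp add: annulus_def)
      qed (use sub in simp_all)
      finally have le: "1 + \<bar>x \<bullet> \<xi>\<bar> \<le> 1 + 2 * r" by simp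
      have "\<bar>?E x\<bar> = \<bar>radial_integral \<alpha> \<xi> (x \<bullet> \<xi>) - C + b * ln \<bar>x \<bullet> \<xi>\<bar>\<bar>"
        using True by simp
      also have "\<dots> \<le> 32 * \<rho>\<^sup>2 * \<alpha> * (1 + \<bar>x \<bullet> \<xi>\<bar>) * \<bar>ln \<bar>x \<bullet> \<xi>\<bar>\<bar>"
        unfolding C_def b_def by (rule radial_integral_expansion[OF \<alpha> \<xi> elim])
      also have "\<dots> \<le> M * \<bar>ln \<bar>x \<bullet> \<xi>\<bar>\<bar>"
        unfolding M_def using le \<alpha> by (intro mult_right_mono mult_left_mono) auto
      finally show ?thesis using True by simp
    qed simp
  qed
  have "(\<integral>x. indicator X x * radial_integral \<alpha> \<xi> (x \<bullet> \<xi>) \<partial>lborel) - measure lborel X * C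
      + b * (\<integral>x. indicator X x * ln \<bar>x \<bullet> \<xi>\<bar> \<partial>lborel) = (\<integral>x. ?E x \<partial>lborel)" (is "?l = _")
    using G Xint ln(1) by simp
  then have "\<bar>?l\<bar> = \<bar>\<integral>x. ?E x \<partial>lborel\<bar>" by (rule arg_cong)
  also have "\<dots> \<le> (\<integral>x. \<bar>?E x\<bar> \<partial>lborel)"
    by (rule integral_abs_bound)
  also have "\<dots> \<le> (\<integral>x. M * (indicator X x * \<bar>ln \<bar>x \<bullet> \<xi>\<bar>\<bar>) \<partial>lborel)"
    by (rule integral_mono_AE[OF integrable_abs[OF E] _ ae]) (rule integrable_mult_right[OF absln])
  also have "\<dots> = M * (\<integral>x. indicator X x * \<bar>ln \<bar>x \<bullet> \<xi>\<bar>\<bar> \<partial>lborel)" by simp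
  also have "\<dots> \<le> M * annulus_ln_bound r"
    using ln(2) ln_bound_annulus[OF \<xi> sub(2)] M by (intro mult_left_mono) auto
  finally show ?thesis by (simp add: b_def C_def M_def)
qed

end

subsection \<open>Comparison of volumes\<close>

lemma content_pos_if_cball_subset:
  fixes M :: "'a::euclidean_space set"
  assumes "compact M" "cball 0 \<delta> \<subseteq> M" "0 < \<delta>"
  shows "0 < measure lborel M"
proof -
  have "emeasure lborel M < \<infinity>"
    using assms(1) by (intro emeasure_bounded_finite compact_imp_bounded)
  then have "measure lborel (cball (0 :: 'a) \<delta>) \<le> measure lborel M"
    using assms borel_compact[OF assms(1)] by (intro measure_mono_fmeasurable) (auto simp: fmeasurable_def)
  moreover have "0 < measure lborel (cball (0 :: 'a) \<delta>)"
    using assms(3) by (simp add: content_cball)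
  ultimately show ?thesis by linarith
qed

context centered_body
begin

text \<open>In the difference of the means the constant
  \<open>radial_integral \<alpha> \<xi> 1\<close> cancels. What remains is the nonnegative weight
  times a difference of mean logarithms, which is at most 0 by assumption, and errors of order
  \<alpha>.\<close>

lemma average_log_potential_le:
  assumes L: "L \<in> sets borel" "L \<subseteq> cball 0 \<rho>" "0 < measure lborel L" and K: "0 < measure lborel K" and \<alpha>: "0 < \<alpha>"
    and ln_le: "\<And>\<xi>. \<xi> \<noteq> 0 \<Longrightarrow> (\<integral>x. indicator L x * ln \<bar>x \<bullet> \<xi>\<bar> \<partial>lborel) / measure lborel L
      \<le> (\<integral>x. indicator K x * ln \<bar>x \<bullet> \<xi>\<bar> \<partial>lborel) / measure lborel K"
  shows "(\<integral>x. indicator K x * log_potential \<alpha> x \<partial>lborel) / measure lborel K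
      - (\<integral>x. indicator L x * log_potential \<alpha> x \<partial>lborel) / measure lborel L
    \<le> \<alpha> * (32 * \<rho>\<^sup>2 * (1 + 2 * \<rho>) * annulus_ln_bound \<rho> * (1 / measure lborel K + 1 / measure lborel L) * measure lborel annulus)"
proof -
  define N where "N = 32 * \<rho>\<^sup>2 * \<alpha> * (1 + 2 * \<rho>) * annulus_ln_bound \<rho>"
  define P where "P X \<xi> = (\<integral>x. indicator X x * radial_integral \<alpha> \<xi> (x \<bullet> \<xi>) \<partial>lborel)" for X \<xi>
  define I where "I X \<xi> = (\<integral>x. indicator X x * ln \<bar>x \<bullet> \<xi>\<bar> \<partial>lborel)" for X and \<xi> :: "real^3"
  let ?v = "measure lborel K" and ?w = "measure lborel L"
  have gap: "P K \<xi> / ?v - P L \<xi> / ?w \<le> N * (1 / ?v + 1 / ?w)" if \<xi>: "\<xi> \<in> annulus" for \<xi>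
  proof -
    define b where "b = smooth_section K e \<xi> 0"
    define C where "C = radial_integral \<alpha> \<xi> 1"
    have b: "0 \<le> b"
      unfolding b_def by (rule smooth_section_0_nonneg[OF compact convex sym annulus_nonzero[OF \<xi>]])
    have PK: "\<bar>P K \<xi> - ?v * C + b * I K \<xi>\<bar> \<le> N" and PL: "\<bar>P L \<xi> - ?w * C + b * I L \<xi>\<bar> \<le> N"
      unfolding P_def C_def b_def I_def N_def
      by (rule integral_radial_expansion[OF borel outer \<rho>_nonneg \<alpha> \<xi>],
        rule integral_radial_expansion[OF L(1,2) \<rho>_nonneg \<alpha> \<xi>])
    have 1: "P K \<xi> / ?v \<le> C - b * (I K \<xi> / ?v) + N / ?v"
    proof -
      have "P K \<xi> \<le> ?v * C - b * I K \<xi> + N" using PK by linarith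
      then have "P K \<xi> / ?v \<le> (?v * C - b * I K \<xi> + N) / ?v"
        using K by (intro divide_right_mono) auto
      then show ?thesis using K by (simp add: add_divide_distrib diff_divide_distrib)
    qed
    have 2: "C - b * (I L \<xi> / ?w) - N / ?w \<le> P L \<xi> / ?w"
    proof -
      have "?w * C - b * I L \<xi> - N \<le> P L \<xi>" using PL by linarith
      then have "(?w * C - b * I L \<xi> - N) / ?w \<le> P L \<xi> / ?w"
        using L(3) by (intro divide_right_mono) auto
      then show ?thesis using L(3) by (simp add: diff_divide_distrib)
    qed
    have "b * (I L \<xi> / ?w) \<le> b * (I K \<xi> / ?v)"
      using ln_le[OF annulus_nonzero[OF \<xi>]] b unfolding I_def by (rule mult_left_mono)
    with 1 2 have "P K \<xi> / ?v - P L \<xi> / ?w \<le> N / ?v + N / ?w" by linarith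
    then show ?thesis by (simp add: distrib_left)
  qed
  have int: "integrable lborel (\<lambda>\<xi>. indicator annulus \<xi> * P K \<xi>)" "integrable lborel (\<lambda>\<xi>. indicator annulus \<xi> * P L \<xi>)"
    unfolding P_def by (rule integrable_annulus_radial[OF borel outer \<rho>_nonneg \<alpha>],
      rule integrable_annulus_radial[OF L(1,2) \<rho>_nonneg \<alpha>])
  have "(\<integral>x. indicator K x * log_potential \<alpha> x \<partial>lborel) / ?v - (\<integral>x. indicator L x * log_potential \<alpha> x \<partial>lborel) / ?w
    = (\<integral>\<xi>. indicator annulus \<xi> * P K \<xi> \<partial>lborel) / ?v - (\<integral>\<xi>. indicator annulus \<xi> * P L \<xi> \<partial>lborel) / ?w"
    unfolding P_def integral_log_potential[OF borel outer \<rho>_nonneg \<alpha>] integral_log_potential[OF L(1,2) \<rho>_nonneg \<alpha>] ..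
  also have "\<dots> = (\<integral>\<xi>. indicator annulus \<xi> * P K \<xi> / ?v - indicator annulus \<xi> * P L \<xi> / ?w \<partial>lborel)"
    using int by (subst Bochner_Integration.integral_diff) auto
  also have "\<dots> \<le> (\<integral>\<xi>. N * (1 / ?v + 1 / ?w) * indicator annulus \<xi> \<partial>lborel)"
  proof (rule integral_mono)
    show "integrable lborel (\<lambda>\<xi>. indicator annulus \<xi> * P K \<xi> / ?v - indicator annulus \<xi> * P L \<xi> / ?w)"
      using int by (intro Bochner_Integration.integrable_diff) auto
    show "integrable lborel (\<lambda>\<xi>. N * (1 / ?v + 1 / ?w) * indicator annulus \<xi>)"
      using emeasure_annulus_finite by (intro integrable_mult_right) (simp add: integrable_indicator_iff)
    show "indicator annulus \<xi> * P K \<xi> / ?v - indicator annulus \<xi> * P L \<xi> / ?w \<le> N * (1 / ?v + 1 / ?w) * indicator annulus \<xi>" for \<xi>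
      using gap[of \<xi>] by (cases "\<xi> \<in> annulus") auto
  qed
  also have "\<dots> = \<alpha> * (32 * \<rho>\<^sup>2 * (1 + 2 * \<rho>) * annulus_ln_bound \<rho> * (1 / ?v + 1 / ?w) * measure lborel annulus)"
    by (simp add: N_def)
  finally show ?thesis .
qed

text \<open>A bathtub argument. The dilate \<open>cK\<close> has the volume of \<open>L\<close>, and
  the potential is at least \<open>a1\<close> on \<open>cK\<close> and at most \<open>a2\<close> off
  it, so replacing \<open>cK\<close> by \<open>L\<close> raises the mean by at most
  \<open>a2 - a1\<close>. Exact scaling relates the mean over \<open>cK\<close> to the mean over
  \<open>K\<close>.\<close>

lemma average_log_potential_ge:
  assumes L [measurable]: "L \<in> sets borel" and sub: "L \<subseteq> cball 0 \<rho>" and K: "0 < measure lborel K"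
    and \<alpha>: "0 < \<alpha>" and c: "1 \<le> c" "\<alpha> * c \<le> 1 - \<eta>" and vol: "measure lborel L = c ^ 3 * measure lborel K"
  shows "mass * (ln c - ln ((1 + \<eta>) / (1 - \<eta>))) \<le>
      (\<integral>x. indicator K x * log_potential \<alpha> x \<partial>lborel) / measure lborel K
      - (\<integral>x. indicator L x * log_potential \<alpha> x \<partial>lborel) / measure lborel L"
proof -
  let ?v = "measure lborel K"
  let ?S = "log_potential \<alpha>"
  define cK where "cK = (\<lambda>x. (1 / c) *\<^sub>R x) -` K"
  have c0: "0 < c" using c by simp
  have cK [measurable]: "cK \<in> sets borel"
    unfolding cK_def by (rule measurable_sets_borel[OF _ borel]) measurable
  have cK_sub: "cK \<subseteq> cball 0 (c * \<rho>)"
  proof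
    fix x assume "x \<in> cK"
    then have "norm ((1 / c) *\<^sub>R x) \<le> \<rho>" using outer by (auto simp: cK_def)
    then show "x \<in> cball 0 (c * \<rho>)" using c0 by (simp add: divide_le_eq mult.commute)
  qed
  have ind_cK: "indicator cK (c *\<^sub>R x) = (indicator K x :: real)" for x
    using c0 by (simp add: cK_def indicator_def)
  have intX: "integrable lborel (indicator X :: real^3 \<Rightarrow> real)" if "X \<in> sets borel" "X \<subseteq> cball 0 r" for X r
    using that emeasure_subset_cball[OF that(2)] by (simp add: integrable_indicator_iff)
  have vol_cK: "measure lborel cK = c ^ 3 * ?v"
  proof -
    have "(\<integral>x. indicator cK x \<partial>lborel) = \<bar>c\<bar> ^ DIM(real^3) * (\<integral>x. indicator cK (c *\<^sub>R x) \<partial>lborel :: real)"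
      using c0 by (intro lborel_integral_scaleR) auto
    then show ?thesis using c0 by (simp add: ind_cK)
  qed
  have SK: "integrable lborel (\<lambda>x. indicator K x * ?S x)" and SL: "integrable lborel (\<lambda>x. indicator L x * ?S x)"
    and ScK: "integrable lborel (\<lambda>x. indicator cK x * ?S x)"
    using \<rho>_nonneg c0 by (auto intro!: integrable_log_potential[OF _ outer] integrable_log_potential[OF L sub]
        integrable_log_potential[OF cK cK_sub] \<alpha>)
  have nz: "AE x in lborel. x \<noteq> (0 :: real^3)"
    by (rule AE_lborel_singleton)
  have scale: "(\<integral>x. indicator cK x * ?S x \<partial>lborel) = c ^ 3 * ((\<integral>x. indicator K x * ?S x \<partial>lborel) - mass * ln c * ?v)"
  proof -
    have "(\<integral>x. indicator cK x * ?S x \<partial>lborel) = \<bar>c\<bar> ^ DIM(real^3) * (\<integral>x. indicator cK (c *\<^sub>R x) * ?S (c *\<^sub>R x) \<partial>lborel)"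
      using c0 by (intro lborel_integral_scaleR) auto
    also have "(\<integral>x. indicator cK (c *\<^sub>R x) * ?S (c *\<^sub>R x) \<partial>lborel) = (\<integral>x. indicator K x * ?S x - mass * ln c * indicator K x \<partial>lborel)"
    proof (rule integral_cong_AE)
      show "AE x in lborel. indicator cK (c *\<^sub>R x) * ?S (c *\<^sub>R x) = indicator K x * ?S x - mass * ln c * indicator K x"
        using nz
      proof eventually_elim
        case (elim x)
        show ?case
          using log_potential_scale[OF \<alpha> elim _ c] by (cases "x \<in> K") (auto simp: ind_cK)
      qed
    qed measurable
    also have "\<dots> = (\<integral>x. indicator K x * ?S x \<partial>lborel) - mass * ln c * ?v"
      using SK intX[OF borel outer] by (subst Bochner_Integration.integral_diff) auto
    finally show ?thesis using c0 by simp
  qed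
  define a1 where "a1 = mass * ln ((1 - \<eta>) / (\<alpha> * c))"
  define a2 where "a2 = mass * ln ((1 + \<eta>) / (\<alpha> * c))"
  have diff: "a2 - a1 = mass * ln ((1 + \<eta>) / (1 - \<eta>))"
  proof -
    have "a2 - a1 = mass * (ln ((1 + \<eta>) / (\<alpha> * c)) - ln ((1 - \<eta>) / (\<alpha> * c)))"
      by (simp add: a1_def a2_def right_diff_distrib)
    also have "ln ((1 + \<eta>) / (\<alpha> * c)) - ln ((1 - \<eta>) / (\<alpha> * c)) = ln ((1 + \<eta>) / (1 - \<eta>))"
      using \<eta> \<alpha> c0 by (simp add: ln_div)
    finally show ?thesis .
  qed
  \<comment> \<open>Subtracting \<open>a1\<close> does not change the integral, because
    \<open>L\<close> and \<open>cK\<close> have equal volume, but it makes the part of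
    \<open>cK\<close> outside \<open>L\<close> contribute at most 0.\<close>
  let ?d = "\<lambda>x. (indicator L x * ?S x - indicator cK x * ?S x) - (a1 * indicator L x - a1 * indicator cK x)"
  have pw: "?d x \<le> (a2 - a1) * indicator L x" if x: "x \<noteq> 0" for x
  proof -
    have "0 < 1 - \<eta>" "\<alpha> * c \<le> 1" using \<eta> c by auto
    then have "a1 \<le> a2"
      unfolding a1_def a2_def using \<eta> \<alpha> c0 by (intro mult_left_mono[OF _ mass_nonneg] ln_mono divide_right_mono) auto
    have "a1 \<le> ?S x" if "x \<in> cK"
      unfolding a1_def using that by (intro log_potential_ge[OF \<alpha> x c0 _ c(2)]) (simp add: cK_def)
    moreover have "?S x \<le> a2" if "x \<notin> cK"
      unfolding a2_def using that \<open>\<alpha> * c \<le> 1\<close> by (intro log_potential_le[OF \<alpha> x c0]) (simp_all add: cK_def)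
    ultimately show ?thesis
      using \<open>a1 \<le> a2\<close> by (cases "x \<in> L"; cases "x \<in> cK") auto
  qed
  have "(\<integral>x. indicator L x * ?S x \<partial>lborel) - (\<integral>x. indicator cK x * ?S x \<partial>lborel) = (\<integral>x. ?d x \<partial>lborel)"
    using SL ScK intX[OF L sub] intX[OF cK cK_sub] by (simp add: vol vol_cK)
  also have "\<dots> \<le> (\<integral>x. (a2 - a1) * indicator L x \<partial>lborel)"
  proof (rule integral_mono_AE)
    show "integrable lborel ?d"
      by (intro Bochner_Integration.integrable_diff integrable_mult_right SL ScK intX[OF L sub] intX[OF cK cK_sub])
    show "integrable lborel (\<lambda>x. (a2 - a1) * indicator L x)"
      by (intro integrable_mult_right intX[OF L sub])
    show "AE x in lborel. ?d x \<le> (a2 - a1) * indicator L x"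
      using nz by eventually_elim (rule pw)
  qed
  also have "\<dots> = mass * ln ((1 + \<eta>) / (1 - \<eta>)) * measure lborel L"
    by (simp add: diff)
  finally have "(\<integral>x. indicator L x * ?S x \<partial>lborel)
      \<le> c ^ 3 * ((\<integral>x. indicator K x * ?S x \<partial>lborel) - mass * ln c * ?v) + mass * ln ((1 + \<eta>) / (1 - \<eta>)) * measure lborel L"
    by (simp add: scale)
  moreover have w: "0 < measure lborel L" using vol K c0 by simp
  ultimately have "(\<integral>x. indicator L x * ?S x \<partial>lborel) / measure lborel L
      \<le> (c ^ 3 * ((\<integral>x. indicator K x * ?S x \<partial>lborel) - mass * ln c * ?v) + mass * ln ((1 + \<eta>) / (1 - \<eta>)) * measure lborel L) / measure lborel L"
    by (intro divide_right_mono) auto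
  also have "\<dots> = (\<integral>x. indicator K x * ?S x \<partial>lborel) / ?v - mass * ln c + mass * ln ((1 + \<eta>) / (1 - \<eta>))"
  proof -
    have "c ^ 3 * ((\<integral>x. indicator K x * ?S x \<partial>lborel) - mass * ln c * ?v) / measure lborel L
      = ((\<integral>x. indicator K x * ?S x \<partial>lborel) - mass * ln c * ?v) / ?v"
      using c0 by (simp add: vol)
    also have "\<dots> = (\<integral>x. indicator K x * ?S x \<partial>lborel) / ?v - mass * ln c"
      using K by (simp add: diff_divide_distrib)
    finally show ?thesis using w by (simp add: add_divide_distrib)
  qed
  finally show ?thesis by (simp add: right_diff_distrib)
qed

end

lemma content_le_of_mean_ln_le:
  fixes K L :: "(real^3) set"
  assumes K: "compact K" "convex K" "\<And>y. y \<in> K \<Longrightarrow> - y \<in> K" "cball 0 \<delta> \<subseteq> K" "0 < \<delta>"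
    and L: "compact L" "0 < measure lborel L"
    and ln_le: "\<And>\<xi>. \<xi> \<noteq> 0 \<Longrightarrow> (\<integral>x. indicator L x * ln \<bar>x \<bullet> \<xi>\<bar> \<partial>lborel) / measure lborel L
      \<le> (\<integral>x. indicator K x * ln \<bar>x \<bullet> \<xi>\<bar> \<partial>lborel) / measure lborel K"
  shows "measure lborel L \<le> measure lborel K"
proof (rule ccontr)
  let ?v = "measure lborel K" and ?w = "measure lborel L"
  assume "\<not> ?w \<le> ?v"
  then have less: "?v < ?w" by simp
  have "bounded (K \<union> L)"
    using K(1) L(1) by (simp add: compact_imp_bounded)
  then obtain \<rho> where \<rho>: "K \<union> L \<subseteq> cball 0 \<rho>"
    by (meson bounded_subset_ballD ball_subset_cball order_trans)
  have Kb: "K \<in> sets borel" and Lb: "L \<in> sets borel"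
    using K(1) L(1) by (auto intro: borel_compact)
  have v: "0 < ?v" by (rule content_pos_if_cball_subset[OF K(1,4,5)])
  \<comment> \<open>The dilate of \<open>K\<close> by this factor has the volume of
    \<open>L\<close>.\<close>
  define c where "c = root 3 (?w / ?v)"
  have c3: "c ^ 3 = ?w / ?v" unfolding c_def by (intro odd_real_root_pow) simp
  have "1 < ?w / ?v" using less v by simp
  then have c: "1 < c" unfolding c_def by simp
  \<comment> \<open>The solution of (1 + q) / (1 - q) = c; taking half of it makes the inequality
    strict.\<close>
  define q where "q = (c - 1) / (c + 1)"
  define h where "h = q / 2"
  have h: "0 < h" "h < 1" "(1 + h) / (1 - h) < c"
  proof -
    have q: "q < 1" "0 < q" using c by (auto simp: q_def)
    then show "0 < h" by (simp add: h_def)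
    have hl: "h < q" "h < 1" using q unfolding h_def by linarith+
    show "h < 1" by fact
    have "h * (c + 1) < c - 1" using hl(1) c by (simp add: q_def less_divide_eq)
    then have "1 + h < c * (1 - h)" by (simp add: algebra_simps)
    then show "(1 + h) / (1 - h) < c" using hl(2) by (simp add: divide_less_eq)
  qed
  \<comment> \<open>Chosen so that the blur \<eta> of the locale becomes \<open>h\<close>.\<close>
  define e where "e = h * \<delta> / 3"
  interpret centered_body K \<delta> \<rho> e
  proof
    show "0 < e" using h K(5) by (simp add: e_def)
    show "3 * e < \<delta>" using h K(5) by (simp add: e_def)
  qed (use K \<rho> in auto)
  have \<eta>_eq: "\<eta> = h" unfolding \<eta>_def using K(5) by (simp add: e_def)
  define \<kappa> where "\<kappa> = mass * (ln c - ln ((1 + \<eta>) / (1 - \<eta>)))"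
  have "ln ((1 + h) / (1 - h)) < ln c"
    using h c by (subst ln_less_cancel_iff) auto
  then have \<kappa>: "0 < \<kappa>"
    using mollifier_mass_pos[OF e_pos] by (simp add: \<kappa>_def \<eta>_eq)
  define M where "M = 32 * \<rho>\<^sup>2 * (1 + 2 * \<rho>) * annulus_ln_bound \<rho> * (1 / ?v + 1 / ?w) * measure lborel annulus"
  have M: "0 \<le> M"
    unfolding M_def using \<rho>_nonneg annulus_ln_bound_nonneg[OF \<rho>_nonneg] by simp
  \<comment> \<open>Neither \<kappa> nor \<open>M\<close> depends on \<alpha>, so it can be chosen
    last. The first bound makes the scaling by \<open>c\<close> exact, the second pushes the error
    below the gain \<kappa>; \<open>M + 1\<close> allows for \<open>M = 0\<close> and gives
    strictness.\<close>
  define \<alpha> where "\<alpha> = min ((1 - \<eta>) / c) (\<kappa> / (M + 1))"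
  have \<alpha>: "0 < \<alpha>" using \<eta> c \<kappa> M by (simp add: \<alpha>_def)
  have "\<alpha> \<le> (1 - \<eta>) / c" by (simp add: \<alpha>_def)
  then have \<alpha>c: "\<alpha> * c \<le> 1 - \<eta>" using c by (simp add: le_divide_eq)
  have "\<alpha> \<le> \<kappa> / (M + 1)" by (simp add: \<alpha>_def)
  then have "\<alpha> * (M + 1) \<le> \<kappa>" using M by (simp add: le_divide_eq)
  then have less_\<kappa>: "\<alpha> * M < \<kappa>" using \<alpha> by (simp add: distrib_left)
  have "\<kappa> \<le> (\<integral>x. indicator K x * log_potential \<alpha> x \<partial>lborel) / ?v - (\<integral>x. indicator L x * log_potential \<alpha> x \<partial>lborel) / ?w"
    unfolding \<kappa>_def using \<rho> c c3 v \<alpha>c by (intro average_log_potential_ge Lb v \<alpha>) auto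
  also have "\<dots> \<le> \<alpha> * M"
    unfolding M_def using \<rho> by (intro average_log_potential_le Lb L(2) v \<alpha> ln_le) auto
  finally show False using less_\<kappa> by simp
qed

section \<open>From the inclusion of polar bodies to mean logarithms\<close>

lemma mean_ln_scaleR:
  fixes M :: "(real^3) set"
  assumes M: "compact M" "0 < measure lborel M" and "\<xi> \<noteq> 0" "0 < s"
  shows "(\<integral>x. indicator M x * ln \<bar>x \<bullet> (s *\<^sub>R \<xi>)\<bar> \<partial>lborel) / measure lborel M
    = (\<integral>x. indicator M x * ln \<bar>x \<bullet> \<xi>\<bar> \<partial>lborel) / measure lborel M + ln s"
proof -
  obtain \<rho> where \<rho>: "M \<subseteq> cball 0 \<rho>" "0 < \<rho>"
    using compact_imp_bounded[OF M(1)] by (meson bounded_subset_ballD ball_subset_cball order_trans)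
  have Mb [measurable]: "M \<in> sets borel" using M(1) by (rule borel_compact)
  have "integrable lborel (\<lambda>x. indicator M x * ln \<bar>x \<bullet> \<xi>\<bar>)"
    using \<rho> assms(3) by (intro integrable_ln_inner(1)[OF Mb]) auto
  moreover have "integrable lborel (indicator M :: real^3 \<Rightarrow> real)"
    using emeasure_subset_cball[OF \<rho>(1)] by (simp add: integrable_indicator_iff)
  moreover have "(\<integral>x. indicator M x * ln \<bar>x \<bullet> (s *\<^sub>R \<xi>)\<bar> \<partial>lborel) = (\<integral>x. indicator M x * ln \<bar>x \<bullet> \<xi>\<bar> + ln s * indicator M x \<partial>lborel)"
  proof (rule integral_cong_AE)
    show "AE x in lborel. indicator M x * ln \<bar>x \<bullet> (s *\<^sub>R \<xi>)\<bar> = indicator M x * ln \<bar>x \<bullet> \<xi>\<bar> + ln s * indicator M x"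
      using AE_inner_nonzero[OF assms(3)]
    proof eventually_elim
      case (elim x)
      then show ?case using assms(4) by (simp add: abs_mult ln_mult distrib_left)
    qed
  qed measurable
  ultimately have "(\<integral>x. indicator M x * ln \<bar>x \<bullet> (s *\<^sub>R \<xi>)\<bar> \<partial>lborel)
    = (\<integral>x. indicator M x * ln \<bar>x \<bullet> \<xi>\<bar> \<partial>lborel) + ln s * measure lborel M"
    by simp
  then show ?thesis using M(2) by (simp add: add_divide_distrib)
qed

lemma polar_0_centroid_functional_eq:
  assumes "compact M" "\<xi> \<noteq> 0"
  shows "polar_0_centroid_functional M \<xi> = exp ((\<integral>x. indicator M x * ln \<bar>x \<bullet> \<xi>\<bar> \<partial>lborel) / measure lborel M)"
proof -
  have [measurable]: "M \<in> sets borel" using assms(1) by (rule borel_compact)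
  have "set_lebesgue_integral lebesgue M (\<lambda>x. ln \<bar>x \<bullet> \<xi>\<bar>) = (\<integral>x. indicator M x * ln \<bar>x \<bullet> \<xi>\<bar> \<partial>lborel)"
    unfolding set_lebesgue_integral_def by (subst integral_completion) auto
  moreover have "vol M = measure lborel M"
    by (simp add: vol_def measure_completion)
  ultimately show ?thesis
    using assms(2) by (simp add: polar_0_centroid_functional_def)
qed

text \<open>The inclusion only tests functionals against 1, so \<xi> is rescaled to where the
  functional of \<open>K\<close> equals 1; scaling adds the same \<open>ln s\<close> to both
  means.\<close>

lemma mean_ln_le_if_polar_0_centroid_body_subset:
  fixes K L :: "(real^3) set"
  assumes K: "compact K" "0 < measure lborel K" and L: "compact L" "0 < measure lborel L"
    and sub: "polar_0_centroid_body K \<subseteq> polar_0_centroid_body L" and "\<xi> \<noteq> 0"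
  shows "(\<integral>x. indicator L x * ln \<bar>x \<bullet> \<xi>\<bar> \<partial>lborel) / measure lborel L
    \<le> (\<integral>x. indicator K x * ln \<bar>x \<bullet> \<xi>\<bar> \<partial>lborel) / measure lborel K" (is "?l \<le> ?h")
proof -
  define s where "s = exp (- ?h)"
  have s: "0 < s" "s *\<^sub>R \<xi> \<noteq> 0" using assms(6) by (auto simp: s_def)
  have ln_s: "ln s = - ?h" by (simp add: s_def)
  have "polar_0_centroid_functional K (s *\<^sub>R \<xi>) = exp (?h + ln s)"
    by (simp only: polar_0_centroid_functional_eq[OF K(1) s(2)] mean_ln_scaleR[OF K assms(6) s(1)])
  then have "s *\<^sub>R \<xi> \<in> polar_0_centroid_body K"
    unfolding ln_s by (simp add: polar_0_centroid_body_def)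
  then have "polar_0_centroid_functional L (s *\<^sub>R \<xi>) \<le> 1"
    using sub by (auto simp: polar_0_centroid_body_def)
  then have "exp (?l + ln s) \<le> 1"
    by (simp only: polar_0_centroid_functional_eq[OF L(1) s(2)] mean_ln_scaleR[OF L assms(6) s(1)])
  then show ?thesis unfolding ln_s by simp
qed

text \<open>Each small \<open>w\<close> is the midpoint of \<open>a + w\<close> and the reflection
  \<open>- (a - w)\<close>. The radius is halved to fit a closed ball into an open one.\<close>

lemma symmetric_convex_body_contains_cball:
  fixes M :: "'a::euclidean_space set"
  assumes "convex_body M" "origin_symmetric M"
  obtains \<delta> where "0 < \<delta>" "cball 0 \<delta> \<subseteq> M"
proof -
  obtain a r where r: "0 < r" "ball a r \<subseteq> M"
    using assms(1) unfolding convex_body_def by (meson ex_in_conv mem_interior)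
  have "cball 0 (r / 2) \<subseteq> M"
  proof
    fix w :: 'a assume "w \<in> cball 0 (r / 2)"
    then have w: "norm w < r" using r(1) by auto
    have 1: "a + w \<in> M" using w r(2) by (auto simp: dist_norm)
    have "a - w \<in> M" using w r(2) by (auto simp: dist_norm)
    then have "- (a - w) \<in> M" using assms(2) unfolding origin_symmetric_def by blast
    with 1 have "(1/2) *\<^sub>R (a + w) + (1/2) *\<^sub>R (- (a - w)) \<in> M"
      using assms(1) unfolding convex_body_def by (intro convexD) auto
    then show "w \<in> M" by (simp add: algebra_simps flip: scaleR_add_left)
  qed
  then show ?thesis using r(1) that[of "r / 2"] by simp
qed

theorem corollary3p6:
  fixes K L :: "(real ^ 3) set"
  assumes "convex_body K" and "origin_symmetric K"
    and "convex_body L" and "origin_symmetric L"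
    and "polar_0_centroid_body K \<subseteq> polar_0_centroid_body L"
  shows "vol L \<le> vol K"
proof -
  have compact: "compact K" "compact L" and conv: "convex K"
    using assms by (auto simp: convex_body_def)
  have sym: "- y \<in> K" if "y \<in> K" for y
    using assms(2) that unfolding origin_symmetric_def by blast
  obtain \<delta> where \<delta>: "0 < \<delta>" "cball 0 \<delta> \<subseteq> K"
    using symmetric_convex_body_contains_cball[OF assms(1,2)] .
  have pos: "0 < measure lborel M" if M: "convex_body M" "origin_symmetric M" for M :: "(real^3) set"
  proof -
    obtain r where "0 < r" "cball 0 r \<subseteq> M"
      using symmetric_convex_body_contains_cball[OF M] .
    then show ?thesis
      using M(1) by (intro content_pos_if_cball_subset) (auto simp: convex_body_def)
  qed
  have "measure lborel L \<le> measure lborel K"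
    using mean_ln_le_if_polar_0_centroid_body_subset[OF compact(1) pos[OF assms(1,2)] compact(2) pos[OF assms(3,4)] assms(5)]
    by (intro content_le_of_mean_ln_le[OF compact(1) conv sym \<delta>(2,1) compact(2) pos[OF assms(3,4)]])
  moreover have "vol M = measure lborel M" if "compact M" for M :: "(real^3) set"
    using borel_compact[OF that] by (simp add: vol_def measure_completion)
  ultimately show ?thesis using compact by simp
qed

end
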